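(* Let $G$ be a Polish group and $K$ an affine $G$-flow. Then there exist an affine $G$-flow $L$ and an affine $G$-irreducible extension $\phi\colon L\to K$ such that $L$ itself has no nontrivial affine $G$-irreducible extensions. Moreover, $L$ is, up to isomorphism, the unique such affine $G$-flow.
   Context: An affine $G$-flow is a (nonempty) compact convex set (a compact convex subset of a Hausdorff locally convex topological vector space) with a continuous action of $G$ by affine homeomorphisms. An affine subflow is a nonempty closed convex $G$-invariant subset. An affine $G$-map is a continuous affine $G$-equivariant map; an affine extension is a surjective affine $G$-map. An isomorphism is a bijective affine $G$-map. An affine extension $\phi\colon L\to K$ is affine $G$-irreducible if $\phi(C)\ne K$ for every proper affine subflow $C\subsetneq L$. An extension is nontrivial if it is not an isomorphism. *)

theory Defs
  imports
    "HOL-Analysis.Analysis"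
    "HOL-Algebra.Group_Action"
begin

section \<open>Hausdorff locally convex spaces\<close>

class locally_convex_t2_space = real_vector + t2_space + topological_ab_group_add +
  assumes tendsto_scaleR_nhds_Pair:
    "LIM p (nhds r \<times>\<^sub>F nhds x). fst p *\<^sub>R snd p :> nhds (r *\<^sub>R x)"
  and convex_nhds_zero_unfolded:
    "open U \<Longrightarrow> 0 \<in> U \<Longrightarrow> \<exists>V. open V \<and> 0 \<in> V \<and>
      (\<forall>x\<in>V. \<forall>y\<in>V. \<forall>u\<ge>0. \<forall>v\<ge>0. u + v = 1 \<longrightarrow> u *\<^sub>R x + v *\<^sub>R y \<in> V) \<and> V \<subseteq> U"

lemma convex_nhds_zero:
  fixes U :: "'a::locally_convex_t2_space set"
  shows "open U \<Longrightarrow> 0 \<in> U \<Longrightarrow> \<exists>V. open V \<and> 0 \<in> V \<and> convex V \<and> V \<subseteq> U"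
  unfolding convex_def by (rule convex_nhds_zero_unfolded)

instance real_normed_vector \<subseteq> locally_convex_t2_space
proof
  fix r :: real and x :: 'a and U :: "'a set"
  show "LIM p (nhds r \<times>\<^sub>F nhds x). fst p *\<^sub>R snd p :> nhds (r *\<^sub>R x)"
    by (intro tendsto_scaleR filterlim_fst filterlim_snd)
  show "\<exists>V. open V \<and> 0 \<in> V \<and>
      (\<forall>x\<in>V. \<forall>y\<in>V. \<forall>u\<ge>0. \<forall>v\<ge>0. u + v = 1 \<longrightarrow> u *\<^sub>R x + v *\<^sub>R y \<in> V) \<and> V \<subseteq> U"
    if "open U" "0 \<in> U"
    unfolding convex_def [symmetric]
    using that by (metis centre_in_ball convex_ball openE open_ball)
qed


section \<open>The product of copies of the real line indexed by a type\<close>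

text \<open>
  A copy of \<open>'i \<Rightarrow> real\<close> with the product topology. The function type itself cannot be made
  an instance of \<^class>\<open>t2_space\<close> for arbitrary \<open>'i\<close>, because the library makes it a metric
  space for countable \<open>'i\<close>.
\<close>

typedef 'i real_power = "UNIV :: ('i \<Rightarrow> real) set"
  morphisms coord Abs_real_power ..

lemmas coord_Abs [simp] = Abs_real_power_inverse [OF UNIV_I]

lemma real_power_eqI: "(\<And>i. coord x i = coord y i) \<Longrightarrow> x = y"
  by (metis coord_inject ext)

instantiation real_power :: (type) real_vector
begin

definition "0 = Abs_real_power (\<lambda>i. 0)"
definition "x + y = Abs_real_power (\<lambda>i. coord x i + coord y i)"
definition "- x = Abs_real_power (\<lambda>i. - coord x i)"
definition "x - y = Abs_real_power (\<lambda>i. coord x i - coord y i)"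
definition "r *\<^sub>R x = Abs_real_power (\<lambda>i. r * coord x i)"

instance
  by standard
    (auto intro!: real_power_eqI simp: zero_real_power_def plus_real_power_def
      uminus_real_power_def minus_real_power_def scaleR_real_power_def algebra_simps)

end

lemma coord_simps [simp]:
  "coord 0 i = 0"
  "coord (x + y) i = coord x i + coord y i"
  "coord (- x) i = - coord x i"
  "coord (x - y) i = coord x i - coord y i"
  "coord (r *\<^sub>R x) i = r * coord x i"
  by (simp_all add: zero_real_power_def plus_real_power_def uminus_real_power_def
      minus_real_power_def scaleR_real_power_def)

instantiation real_power :: (type) topological_space
begin

definition open_real_power_def: "open U \<longleftrightarrow> open (Abs_real_power -` U)"

instance
  by standard (auto simp: open_real_power_def vimage_Int vimage_Union)

end

lemma tendsto_real_power_iff: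
  fixes l :: "'i real_power"
  shows "(f \<longlongrightarrow> l) F \<longleftrightarrow> (\<forall>i. ((\<lambda>x. coord (f x) i) \<longlongrightarrow> coord l i) F)"
proof -
  have "(f \<longlongrightarrow> l) F \<longleftrightarrow> ((\<lambda>x. coord (f x)) \<longlongrightarrow> coord l) F"
  proof
    assume lim: "(f \<longlongrightarrow> l) F"
    show "((\<lambda>x. coord (f x)) \<longlongrightarrow> coord l) F"
    proof (rule topological_tendstoI)
      fix S :: "('i \<Rightarrow> real) set"
      assume "open S" "coord l \<in> S"
      moreover have "Abs_real_power -` (coord -` S) = S"
        by auto
      ultimately show "\<forall>\<^sub>F x in F. coord (f x) \<in> S"
        using topological_tendstoD [OF lim, of "coord -` S"] by (simp add: open_real_power_def)
    qed
  next
    assume lim: "((\<lambda>x. coord (f x)) \<longlongrightarrow> coord l) F"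
    show "(f \<longlongrightarrow> l) F"
    proof (rule topological_tendstoI)
      fix S :: "'i real_power set"
      assume "open S" "l \<in> S"
      then show "\<forall>\<^sub>F x in F. f x \<in> S"
        using topological_tendstoD [OF lim, of "Abs_real_power -` S"]
        by (simp add: open_real_power_def coord_inverse)
    qed
  qed
  also have "\<dots> \<longleftrightarrow> limitin euclidean (\<lambda>x. coord (f x)) (coord l) F"
    by simp
  also have "\<dots> \<longleftrightarrow> limitin (product_topology (\<lambda>i. euclidean) UNIV) (\<lambda>x. coord (f x)) (coord l) F"
    by (simp add: euclidean_product_topology)
  also have "\<dots> \<longleftrightarrow> (\<forall>i. ((\<lambda>x. coord (f x) i) \<longlongrightarrow> coord l i) F)"
    by (simp add: limitin_componentwise)
  finally show ?thesis .
qed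

lemma tendsto_coord: "(f \<longlongrightarrow> l) F \<Longrightarrow> ((\<lambda>x. coord (f x) i) \<longlongrightarrow> coord l i) F"
  by (simp add: tendsto_real_power_iff)

lemma open_coord_vimage:
  assumes "open S" shows "open {x. coord x i \<in> S}"
proof -
  have "open ((\<lambda>f :: 'a \<Rightarrow> real. f i) -` S)"
    by (intro open_vimage assms continuous_on_product_coordinates)
  moreover have "Abs_real_power -` {x. coord x i \<in> S} = (\<lambda>f. f i) -` S"
    by auto
  ultimately show ?thesis
    by (simp add: open_real_power_def)
qed

instance real_power :: (type) t2_space
proof
  fix x y :: "'a real_power"
  assume "x \<noteq> y"
  then obtain i where "coord x i \<noteq> coord y i"
    by (metis real_power_eqI)
  then obtain S S' where "open S" "open S'" "coord x i \<in> S" "coord y i \<in> S'" "S \<inter> S' = {}"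
    by (metis hausdorff)
  then show "\<exists>U V. open U \<and> open V \<and> x \<in> U \<and> y \<in> V \<and> U \<inter> V = {}"
    by (intro exI [of _ "{z. coord z i \<in> S}"] exI [of _ "{z. coord z i \<in> S'}"] conjI
        open_coord_vimage) auto
qed

lemma convex_nhds_zero_real_power:
  fixes U :: "'i real_power set"
  assumes "open U" "0 \<in> U"
  shows "\<exists>V. open V \<and> 0 \<in> V \<and> convex V \<and> V \<subseteq> U"
proof -
  have "openin (product_topology (\<lambda>_::'i. euclidean :: real topology) UNIV) (Abs_real_power -` U)"
    using assms(1) by (simp add: open_real_power_def open_fun_def)
  moreover have "(\<lambda>i. 0) \<in> Abs_real_power -` U"
    using assms(2) by (simp add: zero_real_power_def)
  ultimately obtain X where X: "(\<lambda>i. 0) \<in> Pi\<^sub>E UNIV X" "\<And>i. openin euclidean (X i)"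
    "finite {i. X i \<noteq> topspace euclidean}" "Pi\<^sub>E UNIV X \<subseteq> Abs_real_power -` U"
    using product_topology_open_contains_basis [of "\<lambda>_. euclidean" UNIV] by metis
  have "\<exists>W. open W \<and> 0 \<in> W \<and> convex W \<and> W \<subseteq> X i \<and> (X i = UNIV \<longrightarrow> W = UNIV)" for i
  proof -
    have "open (X i)" "0 \<in> X i"
      using X(1,2) by (auto simp: PiE_iff)
    then show ?thesis
      using convex_nhds_zero [of "X i"] by (metis UNIV_I convex_UNIV open_UNIV top_greatest)
  qed
  then obtain W where W: "\<And>i. open (W i)" "\<And>i. 0 \<in> W i" "\<And>i. convex (W i)"
    "\<And>i. W i \<subseteq> X i" "\<And>i. X i = UNIV \<Longrightarrow> W i = UNIV"
    by metis
  define V where "V = {x. \<forall>i. coord x i \<in> W i}"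
  have "finite {i. W i \<noteq> UNIV}"
    using X(3) by (rule rev_finite_subset) (use W(5) in auto)
  then have "open (Pi\<^sub>E UNIV W)"
    by (intro open_PiE W(1))
  moreover have "Abs_real_power -` V = Pi\<^sub>E UNIV W"
    by (auto simp: V_def)
  ultimately have "open V"
    by (simp add: open_real_power_def)
  moreover have "0 \<in> V"
    using W(2) by (simp add: V_def)
  moreover have "convex V"
    using W(3) unfolding convex_def V_def by simp
  moreover have "V \<subseteq> U"
  proof
    fix x assume "x \<in> V"
    then have "coord x \<in> Pi\<^sub>E UNIV X"
      using W(4) by (auto simp: V_def)
    then show "x \<in> U"
      using X(4) by (auto simp: coord_inverse dest: subsetD)
  qed
  ultimately show ?thesis
    by blast
qed

instance real_power :: (type) locally_convex_t2_space
proof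
  fix a b :: "'a real_power" and r :: real and U :: "'a real_power set"
  show "LIM x (nhds a \<times>\<^sub>F nhds b). fst x + snd x :> nhds (a + b)"
    unfolding tendsto_real_power_iff coord_simps
    by (intro allI tendsto_add tendsto_coord filterlim_fst filterlim_snd)
  show "(uminus \<longlongrightarrow> - a) (nhds a)"
    unfolding tendsto_real_power_iff coord_simps
    by (intro allI tendsto_minus tendsto_coord filterlim_ident)
  show "LIM p (nhds r \<times>\<^sub>F nhds a). fst p *\<^sub>R snd p :> nhds (r *\<^sub>R a)"
    unfolding tendsto_real_power_iff coord_simps
    by (intro allI tendsto_mult tendsto_coord filterlim_fst filterlim_snd)
  show "\<exists>V. open V \<and> 0 \<in> V \<and>
      (\<forall>x\<in>V. \<forall>y\<in>V. \<forall>u\<ge>0. \<forall>v\<ge>0. u + v = 1 \<longrightarrow> u *\<^sub>R x + v *\<^sub>R y \<in> V) \<and> V \<subseteq> U"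
    if "open U" "0 \<in> U"
    unfolding convex_def [symmetric] using that by (rule convex_nhds_zero_real_power)
qed


section \<open>Polish groups\<close>

definition polish_group :: "('g, 'm) monoid_scheme \<Rightarrow> 'g topology \<Rightarrow> bool" where
  "polish_group G T \<longleftrightarrow>
     group G \<and> topspace T = carrier G \<and>
     continuous_map (prod_topology T T) T (\<lambda>(g, h). g \<otimes>\<^bsub>G\<^esub> h) \<and>
     continuous_map T T (\<lambda>g. inv\<^bsub>G\<^esub> g) \<and>
     separable_space T \<and> completely_metrizable_space T"


section \<open>Affine flows and their extensions\<close>

definition affine_map_on :: "'v::real_vector set \<Rightarrow> ('v \<Rightarrow> 'w::real_vector) \<Rightarrow> bool" where
  "affine_map_on K f \<longleftrightarrow>
     (\<forall>x\<in>K. \<forall>y\<in>K. \<forall>t\<in>{0..1}. f ((1 - t) *\<^sub>R x + t *\<^sub>R y) = (1 - t) *\<^sub>R f x + t *\<^sub>R f y)"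

text \<open>
  The action \<open>\<alpha>\<close> is required to be jointly continuous; since \<open>\<alpha> g\<close> and \<open>\<alpha> (inv g)\<close> are inverse
  to each other on \<open>K\<close>, each \<open>\<alpha> g\<close> is then an affine homeomorphism of \<open>K\<close>. By the library's
  definition of \<^locale>\<open>group_action\<close>, \<open>\<alpha> g\<close> has the value \<^const>\<open>undefined\<close> outside \<open>K\<close>.
\<close>

definition affine_flow ::
  "('g, 'm) monoid_scheme \<Rightarrow> 'g topology \<Rightarrow> 'v::locally_convex_t2_space set \<Rightarrow>
    ('g \<Rightarrow> 'v \<Rightarrow> 'v) \<Rightarrow> bool" where
  "affine_flow G T K \<alpha> \<longleftrightarrow>
     K \<noteq> {} \<and> compact K \<and> convex K \<and>
     group_action G K \<alpha> \<and>
     (\<forall>g\<in>carrier G. affine_map_on K (\<alpha> g)) \<and>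
     continuous_map (prod_topology T (top_of_set K)) (top_of_set K) (\<lambda>(g, x). \<alpha> g x)"

definition affine_subflow ::
  "('g, 'm) monoid_scheme \<Rightarrow> 'v::locally_convex_t2_space set \<Rightarrow> ('g \<Rightarrow> 'v \<Rightarrow> 'v) \<Rightarrow>
    'v set \<Rightarrow> bool" where
  "affine_subflow G K \<alpha> C \<longleftrightarrow>
     C \<noteq> {} \<and> C \<subseteq> K \<and> closed C \<and> convex C \<and> (\<forall>g\<in>carrier G. \<alpha> g ` C \<subseteq> C)"

definition affine_G_map ::
  "('g, 'm) monoid_scheme \<Rightarrow> 'v::locally_convex_t2_space set \<Rightarrow> ('g \<Rightarrow> 'v \<Rightarrow> 'v) \<Rightarrow>
    'w::locally_convex_t2_space set \<Rightarrow> ('g \<Rightarrow> 'w \<Rightarrow> 'w) \<Rightarrow> ('v \<Rightarrow> 'w) \<Rightarrow> bool" where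
  "affine_G_map G L \<beta> K \<alpha> \<phi> \<longleftrightarrow>
     \<phi> ` L \<subseteq> K \<and> continuous_on L \<phi> \<and> affine_map_on L \<phi> \<and>
     (\<forall>g\<in>carrier G. \<forall>x\<in>L. \<phi> (\<beta> g x) = \<alpha> g (\<phi> x))"

definition affine_extension ::
  "('g, 'm) monoid_scheme \<Rightarrow> 'v::locally_convex_t2_space set \<Rightarrow> ('g \<Rightarrow> 'v \<Rightarrow> 'v) \<Rightarrow>
    'w::locally_convex_t2_space set \<Rightarrow> ('g \<Rightarrow> 'w \<Rightarrow> 'w) \<Rightarrow> ('v \<Rightarrow> 'w) \<Rightarrow> bool" where
  "affine_extension G L \<beta> K \<alpha> \<phi> \<longleftrightarrow> affine_G_map G L \<beta> K \<alpha> \<phi> \<and> \<phi> ` L = K"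

definition affine_flow_iso ::
  "('g, 'm) monoid_scheme \<Rightarrow> 'v::locally_convex_t2_space set \<Rightarrow> ('g \<Rightarrow> 'v \<Rightarrow> 'v) \<Rightarrow>
    'w::locally_convex_t2_space set \<Rightarrow> ('g \<Rightarrow> 'w \<Rightarrow> 'w) \<Rightarrow> ('v \<Rightarrow> 'w) \<Rightarrow> bool" where
  "affine_flow_iso G L \<beta> K \<alpha> \<phi> \<longleftrightarrow> affine_G_map G L \<beta> K \<alpha> \<phi> \<and> bij_betw \<phi> L K"

definition irreducible_extension ::
  "('g, 'm) monoid_scheme \<Rightarrow> 'v::locally_convex_t2_space set \<Rightarrow> ('g \<Rightarrow> 'v \<Rightarrow> 'v) \<Rightarrow>
    'w::locally_convex_t2_space set \<Rightarrow> ('g \<Rightarrow> 'w \<Rightarrow> 'w) \<Rightarrow> ('v \<Rightarrow> 'w) \<Rightarrow> bool" where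
  "irreducible_extension G L \<beta> K \<alpha> \<phi> \<longleftrightarrow>
     affine_extension G L \<beta> K \<alpha> \<phi> \<and>
     (\<forall>C. affine_subflow G L \<beta> C \<and> C \<noteq> L \<longrightarrow> \<phi> ` C \<noteq> K)"

text \<open>
  HOL cannot quantify over all affine flows inside a formula, so the type of the ambient spaces
  of the extensions considered is an explicit argument.
\<close>

definition no_nontrivial_irreducible_extension ::
  "'u::locally_convex_t2_space itself \<Rightarrow> ('g, 'm) monoid_scheme \<Rightarrow> 'g topology \<Rightarrow>
    'v::locally_convex_t2_space set \<Rightarrow> ('g \<Rightarrow> 'v \<Rightarrow> 'v) \<Rightarrow> bool" where
  "no_nontrivial_irreducible_extension (_ :: 'u itself) G T L \<beta> \<longleftrightarrow>
     (\<forall>(M :: 'u set) \<gamma> \<psi>.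
        affine_flow G T M \<gamma> \<and> irreducible_extension G M \<gamma> L \<beta> \<psi> \<longrightarrow>
        affine_flow_iso G M \<gamma> L \<beta> \<psi>)"

definition maximal_irreducible_over ::
  "'u::locally_convex_t2_space itself \<Rightarrow> ('g, 'm) monoid_scheme \<Rightarrow> 'g topology \<Rightarrow>
    'w::locally_convex_t2_space set \<Rightarrow> ('g \<Rightarrow> 'w \<Rightarrow> 'w) \<Rightarrow>
    'v::locally_convex_t2_space set \<Rightarrow> ('g \<Rightarrow> 'v \<Rightarrow> 'v) \<Rightarrow> bool" where
  "maximal_irreducible_over (U :: 'u itself) G T K \<alpha> L \<beta> \<longleftrightarrow>
     affine_flow G T L \<beta> \<and>
     (\<exists>\<phi>. irreducible_extension G L \<beta> K \<alpha> \<phi>) \<and>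
     no_nontrivial_irreducible_extension U G T L \<beta>"

text \<open>
  A type of ambient spaces that is large enough for all irreducible extensions of a flow
  \<open>K :: 'v set\<close> of a group on \<open>'g\<close>. If \<open>\<phi> : M \<rightarrow> K\<close> is irreducible and \<open>\<phi> (s x) = x\<close> for
  \<open>x \<in> K\<close>, then the closed convex hull of all \<open>g \<cdot> s x\<close> is a subflow mapped onto \<open>K\<close>, hence is
  \<open>M\<close>. So a continuous affine function on \<open>M\<close> is determined by its values at the points
  \<open>g \<cdot> s x\<close>, that is, by an element of \<open>'v \<times> 'g \<Rightarrow> real\<close>. As these functions separate points,
  \<open>M\<close> is isomorphic to a flow in \<open>('v \<times> 'g \<Rightarrow> real) real_power\<close>. The same holds for irreducible
  extensions of \<open>M\<close>, since their compositions with \<open>\<phi>\<close> are irreducible.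

  A theorem that a flow \<open>L\<close> over \<open>K\<close> has no nontrivial irreducible extension at all is obtained
  by proving it for this type and showing that it then holds for an arbitrary type \<open>'b\<close>;
  stated in this order, the choice of \<open>L\<close> does not depend on \<open>'b\<close>.
\<close>

type_synonym ('v, 'g) extension_space = "('v \<times> 'g \<Rightarrow> real) real_power"

end

theory Submission
  imports Defs
begin

text \<open>
  Call an irreducible extension \<open>\<phi> : P \<rightarrow> K\<close> projective if every irreducible extension of \<open>K\<close> is
  reached from \<open>P\<close> by an affine \<open>G\<close>-map over \<open>K\<close>. Such a \<open>P\<close> settles everything.

  Existence: take the fibre product over \<open>K\<close> of all irreducible extensions that live in the space
  \<open>('v, 'g) extension_space\<close> and, by Zorn's lemma, a minimal subflow of it that still covers \<open>K\<close>
  (lemmas \<open>fibre_product\<close> and \<open>exists_irreducible_subflow\<close>). An irreducible extension of \<open>K\<close> is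
  determined, up to isomorphism, by what its continuous affine functions do along the orbits of a
  section of the extension; so every irreducible extension, in whatever space it lives, has an
  isomorphic copy in \<open>('v, 'g) extension_space\<close> (lemma \<open>irreducible_extension_embeds\<close>). Hence the
  minimal subflow itself has a copy \<open>P\<close> there, and \<open>P\<close> reaches the extensions in all other spaces.

  Rigidity: two affine \<open>G\<close>-maps \<open>f\<close> and \<open>g\<close> over \<open>K\<close> between irreducible extensions of \<open>K\<close>
  coincide (lemma \<open>maps_over_irreducible_agree\<close>). Their mean \<open>(f + g) / 2\<close> is again a map over \<open>K\<close>,
  so by irreducibility it is onto. An extreme point of the target that is the value of the mean at \<open>x\<close>
  can only be the midpoint of \<open>f x\<close> and \<open>g x\<close> if \<open>f x = g x\<close>. Thus the image under \<open>f\<close> of the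
  subflow \<open>{f = g}\<close> contains all extreme points of the target; as in the Krein-Milman theorem it is
  the whole target, so \<open>{f = g}\<close> covers \<open>K\<close> and is everything.

  Conclusion: if \<open>\<psi> : M \<rightarrow> P\<close> is irreducible, then so is \<open>M \<rightarrow> K\<close>, and projectivity gives
  \<open>p : P \<rightarrow> M\<close> over \<open>K\<close>, which is onto. Rigidity makes \<open>\<psi> \<circ> p\<close> the identity, so \<open>\<psi>\<close> is an
  isomorphism: \<open>P\<close> is maximal. If \<open>L\<close> is maximal as well, the map \<open>P \<rightarrow> L\<close> over \<open>K\<close> is an irreducible
  extension of \<open>L\<close>, hence an isomorphism; any two maximal \<open>L\<close> are therefore isomorphic, and each
  inherits from \<open>P\<close> that it is maximal with respect to extensions in every space.

  Separation of points from closed convex sets, which both the embedding and rigidity use, is proved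
  from a Hahn-Banach theorem for sublinear functionals.
\<close>

section \<open>The Hahn-Banach theorem\<close>

text \<open>
  A sublinear \<open>q\<close> that is minimal among sublinear functionals is linear: for each \<open>y\<close>, the functional
  \<open>x \<mapsto> inf {q (x + t y) - t q y | t \<ge> 0}\<close> is sublinear and below \<open>q\<close>, hence equal to \<open>q\<close>, and its
  value at \<open>x\<close> is at most \<open>q (x + y) - q y\<close>. Zorn's lemma provides a minimal functional. To reach
  \<open>f w = p w\<close>, the search starts below the same infimum formed from \<open>p\<close> in the direction \<open>w\<close>,
  whose value at \<open>- w\<close> is at most \<open>- p w\<close>.
\<close>
lemma sublinear_majorizes_linear:
  fixes p :: "'v::real_vector \<Rightarrow> real"
  assumes add: "\<And>x y. p (x + y) \<le> p x + p y" and scale: "\<And>t x. 0 \<le> t \<Longrightarrow> p (t *\<^sub>R x) = t * p x"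
  shows "\<exists>f. linear f \<and> (\<forall>x. f x \<le> p x) \<and> f w = p w"
proof -
  define sublin :: "('v \<Rightarrow> real) \<Rightarrow> bool" where
    "sublin q \<longleftrightarrow> (\<forall>x y. q (x + y) \<le> q x + q y) \<and> (\<forall>t x. 0 \<le> t \<longrightarrow> q (t *\<^sub>R x) = t * q x)" for q
  have sl_add: "q (x + y) \<le> q x + q y" and sl_scale: "0 \<le> t \<Longrightarrow> q (t *\<^sub>R x) = t * q x"
    if "sublin q" for q x y t
    using that by (auto simp: sublin_def)
  have sl_0: "q 0 = 0" if "sublin q" for q
    using sl_scale [OF that, of 0 0] by simp
  have sl_neg: "- q (- x) \<le> q x" if "sublin q" for q x
    using sl_add [OF that, of x "- x"] sl_0 [OF that] by simp
  define shift :: "('v \<Rightarrow> real) \<Rightarrow> 'v \<Rightarrow> 'v \<Rightarrow> real" where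
    "shift q y x = (INF t\<in>{0..}. q (x + t *\<^sub>R y) - t * q y)" for q y x
  have bdd: "bdd_below ((\<lambda>t. q (x + t *\<^sub>R y) - t * q y) ` {0..})" if q: "sublin q" for q x y
  proof (rule bdd_belowI2)
    fix t :: real assume "t \<in> {0..}"
    then have "t * q y \<le> q (x + t *\<^sub>R y) + q (- x)"
      using sl_add [OF q, of "x + t *\<^sub>R y" "- x"] sl_scale [OF q, of t y] by simp
    then show "- q (- x) \<le> q (x + t *\<^sub>R y) - t * q y"
      by simp
  qed
  have shift_le: "shift q y x \<le> q (x + t *\<^sub>R y) - t * q y" if "sublin q" "0 \<le> t" for q x y t
    unfolding shift_def by (rule cINF_lower [OF bdd [OF that(1)]]) (use that in simp)
  have shift_greatest: "m \<le> shift q y x"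
    if "\<And>t. 0 \<le> t \<Longrightarrow> m \<le> q (x + t *\<^sub>R y) - t * q y" for m q x y
    unfolding shift_def by (rule cINF_greatest) (use that in auto)
  have sublin_shift: "sublin (shift q y)" if q: "sublin q" for q y
    unfolding sublin_def
  proof (intro conjI allI impI)
    fix x x'
    have "shift q y (x + x') - (q (x + t *\<^sub>R y) - t * q y) \<le> shift q y x'" if t: "0 \<le> t" for t
    proof (rule shift_greatest)
      fix s :: real assume s: "0 \<le> s"
      have "shift q y (x + x') \<le> q ((x + x') + (t + s) *\<^sub>R y) - (t + s) * q y"
        using shift_le [OF q] t s by simp
      also have "(x + x') + (t + s) *\<^sub>R y = (x + t *\<^sub>R y) + (x' + s *\<^sub>R y)"
        by (simp add: algebra_simps)
      also have "q \<dots> \<le> q (x + t *\<^sub>R y) + q (x' + s *\<^sub>R y)"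
        by (rule sl_add [OF q])
      finally show "shift q y (x + x') - (q (x + t *\<^sub>R y) - t * q y) \<le> q (x' + s *\<^sub>R y) - s * q y"
        by (simp add: algebra_simps)
    qed
    then have "shift q y (x + x') - shift q y x' \<le> shift q y x"
      by (intro shift_greatest) (simp add: algebra_simps)
    then show "shift q y (x + x') \<le> shift q y x + shift q y x'"
      by simp
  next
    have le: "t * shift q y x \<le> shift q y (t *\<^sub>R x)" if t: "0 < t" for t x
    proof (rule shift_greatest)
      fix s :: real assume s: "0 \<le> s"
      have "t * shift q y x \<le> t * (q (x + (s / t) *\<^sub>R y) - (s / t) * q y)"
        using shift_le [OF q, of "s / t" y x] t s by (intro mult_left_mono) auto
      also have "\<dots> = q (t *\<^sub>R (x + (s / t) *\<^sub>R y)) - s * q y"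
        using sl_scale [OF q, of t "x + (s / t) *\<^sub>R y"] t by (simp add: right_diff_distrib)
      also have "t *\<^sub>R (x + (s / t) *\<^sub>R y) = t *\<^sub>R x + s *\<^sub>R y"
        using t by (simp add: scaleR_right_distrib)
      finally show "t * shift q y x \<le> q (t *\<^sub>R x + s *\<^sub>R y) - s * q y" .
    qed
    fix t :: real and x assume "0 \<le> t"
    show "shift q y (t *\<^sub>R x) = t * shift q y x"
    proof (cases "t = 0")
      case True
      have "0 \<le> shift q y 0"
        by (rule shift_greatest) (simp add: sl_scale [OF q])
      moreover have "shift q y 0 \<le> 0"
        using shift_le [OF q, of 0 y 0] sl_0 [OF q] by simp
      ultimately show ?thesis
        using True by simp
    next
      case False
      then have t: "0 < t"
        using \<open>0 \<le> t\<close> by simp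
      have "inverse t * shift q y (t *\<^sub>R x) \<le> shift q y (inverse t *\<^sub>R t *\<^sub>R x)"
        by (rule le) (use t in simp)
      then have "shift q y (t *\<^sub>R x) \<le> t * shift q y x"
        using t by (simp add: field_simps)
      with le [OF t, of x] show ?thesis
        by simp
    qed
  qed
  have shift_le_self: "shift q y x \<le> q x" if "sublin q" for q x y
    using shift_le [OF that, of 0 y x] by simp
  (* Starting below the shift of p along w forces f (- w) \<le> - p w, that is, p w \<le> f w. *)
  define A where "A = {q. sublin q \<and> (\<forall>x. q x \<le> shift p w x)}"
  have p: "sublin p"
    using add scale by (simp add: sublin_def)
  have "\<exists>m\<in>A. \<forall>q\<in>A. q \<le> m \<longrightarrow> q = m"
  proof (rule predicate_Zorn)
    show "partial_order_on A (relation_of (\<lambda>m q. q \<le> m) A)"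
      by (rule partial_order_on_relation_ofI) auto
  next
    fix C assume C: "C \<in> Chains (relation_of (\<lambda>m q. q \<le> m) A)"
    show "\<exists>u\<in>A. \<forall>q\<in>C. u \<le> q"
    proof (cases "C = {}")
      case True
      then show ?thesis
        using sublin_shift [OF p, of w] unfolding A_def by blast
    next
      case False
      have tot: "q \<le> q' \<or> q' \<le> q" if "q \<in> C" "q' \<in> C" for q q'
        using C that by (auto simp: Chains_def relation_of_def)
      have CA: "C \<subseteq> A"
        using C by (auto simp: Chains_def relation_of_def)
      (* A chain is bounded below pointwise, and its pointwise infimum is again sublinear. *)
      define u where "u x = (INF q\<in>C. q x)" for x
      have bdd: "bdd_below ((\<lambda>q. q x) ` C)" for x
      proof (rule bdd_belowI2)
        fix q assume "q \<in> C"
        then have q: "sublin q" "q (- x) \<le> shift p w (- x)"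
          using CA by (auto simp: A_def)
        show "- shift p w (- x) \<le> q x"
          using sl_neg [OF q(1), of x] q(2) by simp
      qed
      have u_le: "u x \<le> q x" if "q \<in> C" for q x
        unfolding u_def by (rule cINF_lower [OF bdd that])
      have u_greatest: "m \<le> u x" if "\<And>q. q \<in> C \<Longrightarrow> m \<le> q x" for m x
        unfolding u_def by (rule cINF_greatest) (use False that in auto)
      have "sublin u"
        unfolding sublin_def
      proof (intro conjI allI impI)
        fix x y
        have "u (x + y) - q x \<le> u y" if q: "q \<in> C" for q
        proof (rule u_greatest)
          fix q' assume q': "q' \<in> C"
          from tot [OF q q'] obtain r where r: "r \<in> C" "r \<le> q" "r \<le> q'"
            using q q' by blast
          then have "sublin r"
            using CA by (auto simp: A_def)
          have "u (x + y) \<le> r x + r y"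
            using u_le [OF r(1), of "x + y"] sl_add [OF \<open>sublin r\<close>, of x y] by simp
          also have "\<dots> \<le> q x + q' y"
            using r(2,3) by (simp add: add_mono le_fun_def)
          finally show "u (x + y) - q x \<le> q' y"
            by simp
        qed
        then have "u (x + y) - u y \<le> u x"
          by (intro u_greatest) (simp add: algebra_simps)
        then show "u (x + y) \<le> u x + u y"
          by simp
      next
        have le: "t * u x \<le> u (t *\<^sub>R x)" if t: "0 \<le> t" for t x
        proof (rule u_greatest)
          fix q assume q: "q \<in> C"
          then have "sublin q"
            using CA by (auto simp: A_def)
          then show "t * u x \<le> q (t *\<^sub>R x)"
            using u_le [OF q, of x] t by (simp add: sl_scale mult_left_mono)
        qed
        fix t :: real and x assume "0 \<le> t"
        show "u (t *\<^sub>R x) = t * u x"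
        proof (cases "t = 0")
          case True
          have "q 0 = 0" if "q \<in> C" for q
            using CA that sl_0 by (auto simp: A_def)
          then have "u 0 = (INF q\<in>C. 0)"
            unfolding u_def by (intro INF_cong) auto
          then show ?thesis
            using True False by simp
        next
          case False
          then have t: "0 < t"
            using \<open>0 \<le> t\<close> by simp
          have "inverse t * u (t *\<^sub>R x) \<le> u (inverse t *\<^sub>R t *\<^sub>R x)"
            by (rule le) (use t in simp)
          then have "u (t *\<^sub>R x) \<le> t * u x"
            using t by (simp add: field_simps)
          with le [of t x] t show ?thesis
            by simp
        qed
      qed
      moreover have "u x \<le> shift p w x" for x
      proof -
        obtain q where "q \<in> C"
          using False by blast
        then have "q x \<le> shift p w x"
          using CA by (auto simp: A_def)
        with u_le [OF \<open>q \<in> C\<close>, of x] show ?thesis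
          by simp
      qed
      ultimately show ?thesis
        using u_le by (intro bexI [of _ u]) (auto simp: A_def le_fun_def)
    qed
  qed
  then obtain f where "f \<in> A" and minimal: "\<And>q. q \<in> A \<Longrightarrow> q \<le> f \<Longrightarrow> q = f"
    by blast
  then have f: "sublin f" and f_le: "\<And>x. f x \<le> shift p w x"
    by (auto simp: A_def)
  (* By minimality f does not decrease when shifted, so it is superadditive. *)
  have "shift f y = f" for y
  proof (rule minimal)
    show "shift f y \<in> A"
      using sublin_shift [OF f] order_trans [OF shift_le_self [OF f] f_le] by (simp add: A_def)
    show "shift f y \<le> f"
      using shift_le_self [OF f] by (simp add: le_fun_def)
  qed
  then have "f x + f y \<le> f (x + y)" for x y
    using shift_le [OF f, of 1 y x] by simp
  then have f_add: "f (x + y) = f x + f y" for x y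
    using sl_add [OF f, of x y] by (meson antisym)
  have f_neg: "f (- x) = - f x" for x
    using f_add [of x "- x"] sl_0 [OF f] by simp
  have "linear f"
  proof (rule linearI)
    fix r x
    show "f (r *\<^sub>R x) = r *\<^sub>R f x"
    proof (cases "0 \<le> r")
      case True
      then show ?thesis
        using sl_scale [OF f] by simp
    next
      case False
      then have "f ((- r) *\<^sub>R x) = (- r) * f x"
        by (intro sl_scale [OF f]) simp
      then show ?thesis
        using f_neg [of "r *\<^sub>R x"] by simp
    qed
  qed (rule f_add)
  moreover have "f x \<le> p x" for x
    using f_le [of x] shift_le_self [OF p, of w x] by simp
  moreover have "p w \<le> f w"
    using f_le [of "- w"] shift_le [OF p, of 1 w "- w"] sl_0 [OF p] f_neg [of w] by simp
  ultimately show ?thesis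
    by (meson antisym)
qed

section \<open>Separation in locally convex spaces\<close>

lemma tendsto_scaleR_lc:
  fixes a :: "'v::locally_convex_t2_space"
  assumes "(r \<longlongrightarrow> l) F" "(f \<longlongrightarrow> a) F"
  shows "((\<lambda>x. r x *\<^sub>R f x) \<longlongrightarrow> l *\<^sub>R a) F"
proof -
  have "LIM x F. (r x, f x) :> nhds l \<times>\<^sub>F nhds a"
    using assms by (rule filterlim_Pair)
  from filterlim_compose [OF tendsto_scaleR_nhds_Pair this] show ?thesis
    by simp
qed

lemma tendsto_diff_lc:
  fixes a b :: "'v::locally_convex_t2_space"
  assumes "(f \<longlongrightarrow> a) F" "(g \<longlongrightarrow> b) F"
  shows "((\<lambda>x. f x - g x) \<longlongrightarrow> a - b) F"
  using tendsto_add [OF assms(1) tendsto_minus [OF assms(2)]] by simp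

lemma continuous_on_affine_expr:
  fixes c y :: "'v::locally_convex_t2_space"
  shows "continuous_on A (\<lambda>x. c + r *\<^sub>R (x - y))"
  unfolding continuous_on_def
  by (intro ballI tendsto_add tendsto_scaleR_lc tendsto_diff_lc tendsto_const tendsto_ident_at)

text \<open>
  The Hahn-Banach theorem applied to the Minkowski gauge \<open>p x = inf {t > 0 | x / t \<in> D}\<close>: it is at
  most \<open>1\<close> on \<open>D\<close> and, since \<open>D\<close> is convex and contains \<open>0\<close>, at least \<open>1\<close> outside. The
  neighbourhood \<open>N\<close> of \<open>0\<close> makes \<open>D\<close> absorbing, so that the infimum is over a nonempty set.
\<close>
lemma linear_functional_bounded_on_convex_nhd:
  fixes D :: "'v::locally_convex_t2_space set"
  assumes "convex D" "open N" "0 \<in> N" "N \<subseteq> D" "w \<notin> D"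
  shows "\<exists>f. linear f \<and> (\<forall>x\<in>D. f x \<le> 1) \<and> 1 \<le> (f w :: real)"
proof -
  define S where "S x = {t. 0 < t \<and> x \<in> (\<lambda>d. t *\<^sub>R d) ` D}" for x
  define p where "p x = Inf (S x)" for x
  have S_iff: "t \<in> S x \<longleftrightarrow> 0 < t \<and> (1 / t) *\<^sub>R x \<in> D" for t x
  proof (cases "0 < t")
    case True
    have "x = t *\<^sub>R d \<longleftrightarrow> (1 / t) *\<^sub>R x = d" for d
      using True by auto
    then show ?thesis
      using True by (auto simp: S_def)
  qed (simp add: S_def)
  have S_nonempty: "S x \<noteq> {}" for x
  proof -
    have "((\<lambda>r. r *\<^sub>R x) \<longlongrightarrow> 0 *\<^sub>R x) (at_right 0)"
      by (intro tendsto_scaleR_lc tendsto_const tendsto_ident_at)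
    then have "\<forall>\<^sub>F r in at_right 0. r *\<^sub>R x \<in> N"
      using assms(2,3) by (auto dest: topological_tendstoD)
    moreover have "\<forall>\<^sub>F r in at_right (0::real). 0 < r"
      by (simp add: eventually_at_right_less)
    ultimately have "\<forall>\<^sub>F r in at_right 0. r *\<^sub>R x \<in> N \<and> 0 < r"
      by (rule eventually_conj)
    then obtain r where "r *\<^sub>R x \<in> N" "0 < r"
      using eventually_happens' [OF trivial_limit_at_right_real] by blast
    then have "1 / r \<in> S x"
      using assms(4) by (auto simp: S_iff)
    then show ?thesis
      by blast
  qed
  have S_bdd: "bdd_below (S x)" for x
    by (rule bdd_belowI [of _ 0]) (simp add: S_iff)
  have p_le: "p x \<le> t" if "t \<in> S x" for x t
    unfolding p_def using that S_bdd by (rule cInf_lower)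
  have p_greatest: "m \<le> p x" if "\<And>t. t \<in> S x \<Longrightarrow> m \<le> t" for x m
    unfolding p_def using S_nonempty that by (rule cInf_greatest)
  have S_add: "s + t \<in> S (x + y)" if "s \<in> S x" "t \<in> S y" for s t x y
  proof -
    have st: "0 < s" "0 < t" "(1 / s) *\<^sub>R x \<in> D" "(1 / t) *\<^sub>R y \<in> D"
      using that by (auto simp: S_iff)
    have "(s / (s + t)) *\<^sub>R (1 / s) *\<^sub>R x + (t / (s + t)) *\<^sub>R (1 / t) *\<^sub>R y \<in> D"
      using st by (intro convexD [OF assms(1)]) (auto simp flip: add_divide_distrib)
    then show ?thesis
      using st by (simp add: S_iff scaleR_right_distrib)
  qed
  have "\<exists>f. linear f \<and> (\<forall>x. f x \<le> p x) \<and> f w = p w"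
  proof (rule sublinear_majorizes_linear)
    fix x y
    have "p (x + y) - s \<le> p y" if "s \<in> S x" for s
    proof (rule p_greatest)
      fix t assume "t \<in> S y"
      from p_le [OF S_add [OF that this]] show "p (x + y) - s \<le> t"
        by simp
    qed
    then have "p (x + y) - p y \<le> p x"
      by (intro p_greatest) (simp add: algebra_simps)
    then show "p (x + y) \<le> p x + p y"
      by simp
  next
    have S_scale: "t * s \<in> S (t *\<^sub>R x)" if "0 < t" "s \<in> S x" for s t x
      using that by (auto simp: S_iff)
    have le: "p (t *\<^sub>R x) \<le> t * p x" if t: "0 < t" for t x
    proof -
      have "p (t *\<^sub>R x) / t \<le> p x"
        by (rule p_greatest) (use p_le [OF S_scale [OF t]] t in \<open>simp add: field_simps\<close>)
      then show ?thesis
        using t by (simp add: field_simps)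
    qed
    fix t :: real and x assume "0 \<le> t"
    show "p (t *\<^sub>R x) = t * p x"
    proof (cases "t = 0")
      case True
      have "S 0 = {0<..}"
        using assms(3,4) by (auto simp: S_iff)
      then show ?thesis
        using True by (simp add: p_def)
    next
      case False
      then have t: "0 < t"
        using \<open>0 \<le> t\<close> by simp
      have "p (inverse t *\<^sub>R t *\<^sub>R x) \<le> inverse t * p (t *\<^sub>R x)"
        by (rule le) (use t in simp)
      with le [OF t, of x] t show ?thesis
        by (simp add: field_simps)
    qed
  qed
  then obtain f where f: "linear f" "\<And>x. f x \<le> p x" "f w = p w"
    by blast
  have "f x \<le> 1" if "x \<in> D" for x
    using order_trans [OF f(2) p_le [of 1 x]] that by (simp add: S_iff)
  moreover have "1 \<le> p w"
  proof (rule p_greatest, rule ccontr)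
    fix t assume t: "t \<in> S w" "\<not> 1 \<le> t"
    then have "t *\<^sub>R (1 / t) *\<^sub>R w + (1 - t) *\<^sub>R 0 \<in> D"
      using assms(3,4) by (intro convexD [OF assms(1)]) (auto simp: S_iff)
    then show False
      using t assms(5) by (simp add: S_iff)
  qed
  ultimately show ?thesis
    using f by auto
qed

lemma continuous_linear_functional:
  fixes f :: "'v::locally_convex_t2_space \<Rightarrow> real"
  assumes "linear f" "open N" "0 \<in> N" and le: "\<And>x. x \<in> N \<Longrightarrow> f x \<le> 1"
  shows "continuous_on UNIV f"
  unfolding continuous_on_topological
proof (intro ballI allI impI)
  interpret f: linear f by fact
  fix x :: 'v and B :: "real set"
  assume "open B" "f x \<in> B"
  then obtain e where e: "0 < e" "\<And>y. dist y (f x) < e \<Longrightarrow> y \<in> B"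
    unfolding open_dist by blast
  define d where "d = 2 / e"
  define A where "A = {y. 0 + d *\<^sub>R (y - x) \<in> N \<and> 0 + (- d) *\<^sub>R (y - x) \<in> N}"
  have "open A"
    unfolding A_def
    by (intro open_Collect_conj open_vimage [OF \<open>open N\<close>, unfolded vimage_def]
        continuous_on_affine_expr)
  moreover have "x \<in> A"
    using assms(3) by (simp add: A_def)
  moreover have "f y \<in> B" if "y \<in> A" for y
  proof (rule e(2))
    have "d * (f y - f x) \<le> 1" "(- d) * (f y - f x) \<le> 1"
      using that le [of "0 + d *\<^sub>R (y - x)"] le [of "0 + (- d) *\<^sub>R (y - x)"]
      by (auto simp: A_def f.scaleR f.diff f.neg)
    then have "\<bar>d * (f y - f x)\<bar> \<le> 1"
      by linarith
    then have "d * \<bar>f y - f x\<bar> \<le> 1"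
      using e(1) by (simp only: abs_mult) (simp add: d_def)
    then have "2 * \<bar>f y - f x\<bar> \<le> 1 * e"
      by (simp only: d_def times_divide_eq_left pos_divide_le_eq [OF e(1)])
    then show "dist (f y) (f x) < e"
      using e(1) by (simp add: dist_real_def)
  qed
  ultimately show "\<exists>A. open A \<and> x \<in> A \<and> (\<forall>y\<in>UNIV. y \<in> A \<longrightarrow> f y \<in> B)"
    by blast
qed

lemma separation_point_closed_convex:
  fixes C :: "'v::locally_convex_t2_space set"
  assumes "closed C" "convex C" "y \<notin> C"
  shows "\<exists>f. linear f \<and> continuous_on UNIV f \<and> (\<forall>x\<in>C. f x < (f y :: real))"
proof (cases "C = {}")
  case True
  have "linear (\<lambda>x::'v. 0::real)"
    by (simp add: linear_iff)
  then show ?thesis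
    using True by (intro exI [of _ "\<lambda>x. 0"]) auto
next
  case False
  then obtain c where c: "c \<in> C"
    by blast
  have "open {v. y + 1 *\<^sub>R (v - 0) \<in> - C}"
    using assms(1) continuous_on_affine_expr [of UNIV y 1 0]
    by (intro open_vimage [of "- C", unfolded vimage_def]) (auto simp: open_Compl)
  moreover have "0 \<in> {v. y + 1 *\<^sub>R (v - 0) \<in> - C}"
    using assms(3) by simp
  ultimately obtain V where V: "open V" "0 \<in> V" "convex V" "V \<subseteq> {v. y + 1 *\<^sub>R (v - 0) \<in> - C}"
    using convex_nhds_zero by metis
  (* D = (C - c) - V is a convex neighbourhood of 0 that contains C - c and avoids y - c. *)
  define D where "D = (\<Union>x\<in>C. \<Union>v\<in>V. {x - c - v})"
  define N where "N = {x. 0 + (- 1) *\<^sub>R (x - 0) \<in> V}"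
  have "open N"
    unfolding N_def
    by (intro open_vimage [OF V(1), unfolded vimage_def] continuous_on_affine_expr)
  have "0 \<in> N"
    using V(2) by (simp add: N_def)
  have "N \<subseteq> D"
  proof
    fix x assume "x \<in> N"
    then have "- x \<in> V" "x = c - c - (- x)"
      by (auto simp: N_def)
    then show "x \<in> D"
      using c unfolding D_def by blast
  qed
  have "convex D"
  proof (rule convexI)
    fix x x' and s t :: real assume st: "0 \<le> s" "0 \<le> t" "s + t = 1" and "x \<in> D" "x' \<in> D"
    then obtain a v a' v' where *: "a \<in> C" "v \<in> V" "a' \<in> C" "v' \<in> V" "x = a - c - v" "x' = a' - c - v'"
      by (auto simp: D_def)
    have "s *\<^sub>R x + t *\<^sub>R x' = (s *\<^sub>R a + t *\<^sub>R a') - (s + t) *\<^sub>R c - (s *\<^sub>R v + t *\<^sub>R v')"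
      unfolding * by (simp add: algebra_simps)
    moreover have "s *\<^sub>R a + t *\<^sub>R a' \<in> C" "s *\<^sub>R v + t *\<^sub>R v' \<in> V"
      using * st assms(2) V(3) by (auto intro: convexD)
    ultimately show "s *\<^sub>R x + t *\<^sub>R x' \<in> D"
      using st(3) unfolding D_def by auto
  qed
  have "y - c \<notin> D"
  proof
    assume "y - c \<in> D"
    then obtain a v where "a \<in> C" "v \<in> V" "y - c = a - c - v"
      by (auto simp: D_def)
    then have "y + v \<in> C"
      by (simp add: algebra_simps)
    then show False
      using V(4) \<open>v \<in> V\<close> by auto
  qed
  then obtain f :: "'v \<Rightarrow> real" where f: "linear f" "\<And>x. x \<in> D \<Longrightarrow> f x \<le> 1" "1 \<le> f (y - c)"
    using linear_functional_bounded_on_convex_nhd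
      [OF \<open>convex D\<close> \<open>open N\<close> \<open>0 \<in> N\<close> \<open>N \<subseteq> D\<close>] by blast
  interpret f: linear f by fact
  have "continuous_on UNIV f"
    using f(1) \<open>open N\<close> \<open>0 \<in> N\<close> by (rule continuous_linear_functional) (use f(2) \<open>N \<subseteq> D\<close> in auto)
  moreover have "f x < f y" if "x \<in> C" for x
  proof -
    have "((\<lambda>r. r *\<^sub>R (c - y)) \<longlongrightarrow> 0 *\<^sub>R (c - y)) (at_right 0)"
      by (intro tendsto_scaleR_lc tendsto_const tendsto_ident_at)
    then have "\<forall>\<^sub>F r in at_right 0. r *\<^sub>R (c - y) \<in> V"
      using V(1,2) by (auto dest: topological_tendstoD)
    moreover have "\<forall>\<^sub>F r in at_right (0::real). 0 < r"
      by (simp add: eventually_at_right_less)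
    ultimately have "\<forall>\<^sub>F r in at_right 0. r *\<^sub>R (c - y) \<in> V \<and> 0 < r"
      by (rule eventually_conj)
    then obtain r where r: "r *\<^sub>R (c - y) \<in> V" "0 < r"
      using eventually_happens' [OF trivial_limit_at_right_real] by blast
    (* Subtracting the small vector r (c - y) of V turns the weak inequality f x - f c \<le> 1 into a
       strict one, because f (c - y) \<le> - 1. *)
    have "x - c - r *\<^sub>R (c - y) \<in> D"
      using that r(1) by (auto simp: D_def)
    from f(2) [OF this] have "f x - f c + r * (f y - f c) \<le> 1"
      by (simp add: f.diff f.scaleR right_diff_distrib)
    moreover have "1 \<le> f y - f c"
      using f(3) by (simp add: f.diff)
    moreover from this have "0 < r * (f y - f c)"
      using r(2) by simp
    ultimately show ?thesis
      by linarith
  qed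
  ultimately show ?thesis
    using f(1) by blast
qed

section \<open>Minimal compact sets and extreme points\<close>

lemma minimal_member_chain_Inter:
  fixes \<F> :: "'a set set"
  assumes "S0 \<in> \<F>"
    and Inter: "\<And>\<C>. \<C> \<noteq> {} \<Longrightarrow> \<C> \<subseteq> \<F> \<Longrightarrow> (\<And>A B. A \<in> \<C> \<Longrightarrow> B \<in> \<C> \<Longrightarrow> A \<subseteq> B \<or> B \<subseteq> A) \<Longrightarrow> \<Inter>\<C> \<in> \<F>"
  obtains M where "M \<in> \<F>" "\<And>A. A \<in> \<F> \<Longrightarrow> A \<subseteq> M \<Longrightarrow> A = M"
proof -
  have "\<exists>M\<in>\<F>. \<forall>A\<in>\<F>. A \<subseteq> M \<longrightarrow> A = M"
  proof (rule predicate_Zorn)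
    show "partial_order_on \<F> (relation_of (\<lambda>M A. A \<subseteq> M) \<F>)"
      by (rule partial_order_on_relation_ofI) auto
  next
    fix \<C> assume "\<C> \<in> Chains (relation_of (\<lambda>M A. A \<subseteq> M) \<F>)"
    then have "\<C> \<subseteq> \<F>" "\<And>A B. A \<in> \<C> \<Longrightarrow> B \<in> \<C> \<Longrightarrow> A \<subseteq> B \<or> B \<subseteq> A"
      by (auto simp: Chains_def relation_of_def)
    then show "\<exists>U\<in>\<F>. \<forall>A\<in>\<C>. U \<subseteq> A"
      using Inter [of \<C>] assms(1) by (cases "\<C> = {}") (auto intro!: bexI [of _ "\<Inter>\<C>"])
  qed
  with that show ?thesis
    by (elim bexE) simp
qed

lemma Inter_chain_compact_nonempty:
  fixes \<C> :: "'a::t2_space set set"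
  assumes ne: "\<C> \<noteq> {}" and A: "\<And>A. A \<in> \<C> \<Longrightarrow> compact A \<and> A \<noteq> {}"
    and chain: "\<And>A B. A \<in> \<C> \<Longrightarrow> B \<in> \<C> \<Longrightarrow> A \<subseteq> B \<or> B \<subseteq> A"
  shows "\<Inter>\<C> \<noteq> {}"
proof -
  obtain S where S: "S \<in> \<C>"
    using ne by blast
  have min: "\<exists>B\<in>\<C>. B \<subseteq> \<Inter>F" if "finite F" "F \<subseteq> \<C>" for F
    using that
  proof (induction rule: finite_induct)
    case empty
    then show ?case using S by auto
  next
    case (insert A F)
    then obtain B where "B \<in> \<C>" "B \<subseteq> \<Inter>F" by blast
    moreover have "A \<subseteq> B \<or> B \<subseteq> A"
      using chain insert.prems \<open>B \<in> \<C>\<close> by simp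
    ultimately show ?case
      using insert.prems by auto
  qed
  have "S \<inter> \<Inter>\<C> \<noteq> {}"
  proof (rule compact_imp_fip)
    fix F assume "finite F" "F \<subseteq> \<C>"
    then obtain B where "B \<in> \<C>" "B \<subseteq> \<Inter>(insert S F)"
      using min [of "insert S F"] S by auto
    moreover have "B \<noteq> {}"
      using A \<open>B \<in> \<C>\<close> by simp
    ultimately show "S \<inter> \<Inter>F \<noteq> {}"
      by blast
  qed (use A S compact_imp_closed in auto)
  then show ?thesis
    by blast
qed

text \<open>
  A minimal nonempty compact face inside the face where \<open>f\<close> is maximal consists of a single point:
  if it had two, a continuous linear functional separating them would cut out a smaller face.
\<close>
lemma extreme_point_maximizing:
  fixes S :: "'v::locally_convex_t2_space set"
  assumes S: "compact S" "convex S" "S \<noteq> {}" and f: "linear f" "continuous_on UNIV f"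
  shows "\<exists>e. e extreme_point_of S \<and> (\<forall>x\<in>S. f x \<le> (f e :: real))"
proof -
  have top_face: "\<exists>F. F face_of A \<and> compact F \<and> F \<noteq> {} \<and> (\<forall>e\<in>F. \<forall>x\<in>A. g x \<le> g e)"
    if A: "compact A" "convex A" "A \<noteq> {}" and g: "linear g" "continuous_on UNIV g"
    for A and g :: "'v \<Rightarrow> real"
  proof -
    interpret g: linear g by fact
    obtain m where m: "m \<in> A" "\<And>x. x \<in> A \<Longrightarrow> g x \<le> g m"
      using continuous_attains_sup [OF A(1,3) continuous_on_subset [OF g(2) subset_UNIV]] by blast
    define F where "F = A \<inter> {x. g x = g m}"
    have "F face_of A"
      unfolding face_of_def
    proof (intro conjI ballI impI)
      show "F \<subseteq> A"
        by (simp add: F_def)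
      show "convex F"
        unfolding F_def
        by (rule convex_Int [OF A(2)], rule convexI) (simp add: g.add g.scaleR flip: distrib_right)
      fix a b x assume ab: "a \<in> A" "b \<in> A" and "x \<in> F" and "x \<in> open_segment a b"
      then obtain u where u: "0 < u" "u < 1" "x = (1 - u) *\<^sub>R a + u *\<^sub>R b"
        by (auto simp: in_segment)
      have "g m = (1 - u) * g a + u * g b"
        using \<open>x \<in> F\<close> unfolding u(3) F_def by (simp add: g.add g.scaleR)
      then have "(1 - u) * (g m - g a) + u * (g m - g b) = 0"
        by (simp add: algebra_simps)
      moreover have "0 \<le> (1 - u) * (g m - g a)" "0 \<le> u * (g m - g b)"
        using u m(2) ab by auto
      ultimately have "(1 - u) * (g m - g a) = 0" "u * (g m - g b) = 0"
        by linarith+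
      then have "g a = g m" "g b = g m"
        using u(1,2) by simp_all
      then show "a \<in> F" "b \<in> F"
        using ab by (simp_all add: F_def)
    qed
    moreover have "closed {x. g x = g m}"
      by (intro closed_Collect_eq g(2) continuous_on_const)
    with A(1) have "compact F"
      unfolding F_def by (rule compact_Int_closed)
    moreover have "m \<in> F" "\<forall>e\<in>F. \<forall>x\<in>A. g x \<le> g e"
      using m by (auto simp: F_def)
    ultimately show ?thesis
      by blast
  qed
  obtain F0 where F0: "F0 face_of S" "compact F0" "F0 \<noteq> {}" "\<forall>e\<in>F0. \<forall>x\<in>S. f x \<le> f e"
    using top_face [OF S f] by blast
  define \<F> where "\<F> = {F. F face_of S \<and> compact F \<and> F \<noteq> {} \<and> F \<subseteq> F0}"
  obtain M where "M \<in> \<F>" and minimal: "\<And>A. A \<in> \<F> \<Longrightarrow> A \<subseteq> M \<Longrightarrow> A = M"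
  proof (rule minimal_member_chain_Inter)
    show "F0 \<in> \<F>"
      using F0 by (simp add: \<F>_def)
    fix \<C> assume \<C>: "\<C> \<noteq> {}" "\<C> \<subseteq> \<F>" "\<And>A B. A \<in> \<C> \<Longrightarrow> B \<in> \<C> \<Longrightarrow> A \<subseteq> B \<or> B \<subseteq> A"
    have "\<Inter>\<C> face_of S"
      using \<C>(1,2) by (intro face_of_Inter) (auto simp: \<F>_def)
    moreover have "compact (\<Inter>\<C>)"
    proof -
      obtain S where S: "S \<in> \<C>" "compact S"
        using \<C>(1,2) by (auto simp: \<F>_def)
      have "closed (\<Inter>\<C>)"
        using \<C>(2) by (intro closed_Inter) (auto simp: \<F>_def intro: compact_imp_closed)
      then have "compact (S \<inter> \<Inter>\<C>)"
        using S(2) by (intro compact_Int_closed)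
      then show ?thesis
        using S(1) by (simp add: Int_absorb1 [OF Inter_lower])
    qed
    moreover have "\<Inter>\<C> \<noteq> {}"
      by (rule Inter_chain_compact_nonempty [OF \<C>(1) _ \<C>(3)]) (use \<C>(2) in \<open>auto simp: \<F>_def\<close>)
    moreover have "\<Inter>\<C> \<subseteq> F0"
      using \<C>(1,2) by (auto simp: \<F>_def)
    ultimately show "\<Inter>\<C> \<in> \<F>"
      by (simp add: \<F>_def)
  qed (rule that)
  then have M: "M face_of S" "compact M" "M \<noteq> {}" "M \<subseteq> F0"
    by (auto simp: \<F>_def)
  then obtain e where e: "e \<in> M"
    by blast
  have "y = e" if y: "y \<in> M" for y
  proof (rule ccontr)
    assume "y \<noteq> e"
    then obtain g :: "'v \<Rightarrow> real" where g: "linear g" "continuous_on UNIV g" "g e < g y"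
      using separation_point_closed_convex [of "{e}" y] by blast
    obtain F where F: "F face_of M" "compact F" "F \<noteq> {}" "\<forall>a\<in>F. \<forall>x\<in>M. g x \<le> g a"
      using top_face [OF M(2) face_of_imp_convex [OF M(1)] M(3) g(1,2)] by blast
    then have "F \<subseteq> M"
      by (simp add: face_of_imp_subset)
    then have "F \<in> \<F>"
      using F(2,3) \<open>F \<subseteq> M\<close> M(4) face_of_trans [OF F(1) M(1)] by (auto simp: \<F>_def)
    then have "F = M"
      using \<open>F \<subseteq> M\<close> by (rule minimal)
    with F(4) have "\<forall>a\<in>M. \<forall>x\<in>M. g x \<le> g a"
      by simp
    with e y have "g y \<le> g e"
      by simp
    then show False
      using g(3) by simp
  qed
  then have "M = {e}"
    using e by blast
  then have "e extreme_point_of S"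
    using M(1) by (simp add: face_of_singleton)
  then show ?thesis
    using F0(4) e M(4) by auto
qed

section \<open>Affine maps\<close>

lemma affine_map_onD:
  assumes "affine_map_on K f" "x \<in> K" "y \<in> K" "0 \<le> t" "t \<le> 1"
  shows "f ((1 - t) *\<^sub>R x + t *\<^sub>R y) = (1 - t) *\<^sub>R f x + t *\<^sub>R f y"
  using assms by (simp add: affine_map_on_def)

lemma affine_map_on_subset: "affine_map_on K f \<Longrightarrow> C \<subseteq> K \<Longrightarrow> affine_map_on C f"
  by (auto simp: affine_map_on_def)

lemma affine_map_on_cong:
  assumes "convex K" "affine_map_on K f" "\<And>x. x \<in> K \<Longrightarrow> g x = f x"
  shows "affine_map_on K g"
  using assms by (simp add: affine_map_on_def convex_alt)

lemma affine_map_on_compose: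
  assumes "affine_map_on K f" "affine_map_on L g" "f ` K \<subseteq> L"
  shows "affine_map_on K (\<lambda>x. g (f x))"
  using assms by (simp add: affine_map_on_def image_subset_iff)

lemma affine_map_on_linear: "linear f \<Longrightarrow> affine_map_on K f"
  by (simp add: affine_map_on_def linear_add linear_scale)

lemma convex_affine_image:
  assumes "affine_map_on K f" "C \<subseteq> K" "convex C"
  shows "convex (f ` C)"
  unfolding convex_alt
proof (intro ballI allI impI)
  fix y y' :: 'b and u :: real
  assume "y \<in> f ` C" "y' \<in> f ` C" and u: "0 \<le> u \<and> u \<le> 1"
  then obtain x x' where x: "x \<in> C" "x' \<in> C" "y = f x" "y' = f x'"
    by blast
  then have "(1 - u) *\<^sub>R y + u *\<^sub>R y' = f ((1 - u) *\<^sub>R x + u *\<^sub>R x')"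
    using affine_map_onD [OF assms(1) subsetD [OF assms(2)] subsetD [OF assms(2)], of x x' u] u by simp
  moreover have "(1 - u) *\<^sub>R x + u *\<^sub>R x' \<in> C"
    using assms(3) x u by (simp add: convex_alt)
  ultimately show "(1 - u) *\<^sub>R y + u *\<^sub>R y' \<in> f ` C"
    by blast
qed

lemma affine_map_on_inv_into:
  assumes "affine_map_on K f" "convex K" "inj_on f K"
  shows "affine_map_on (f ` K) (inv_into K f)"
  unfolding affine_map_on_def
proof (intro ballI)
  fix y y' :: 'b and u :: real
  assume "y \<in> f ` K" "y' \<in> f ` K" and u: "u \<in> {0..1}"
  then obtain x x' where x: "x \<in> K" "x' \<in> K" "y = f x" "y' = f x'"
    by blast
  have "(1 - u) *\<^sub>R x + u *\<^sub>R x' \<in> K"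
    using assms(2) x u by (simp add: convex_alt)
  moreover have "(1 - u) *\<^sub>R y + u *\<^sub>R y' = f ((1 - u) *\<^sub>R x + u *\<^sub>R x')"
    using affine_map_onD [OF assms(1), of x x' u] x u by auto
  ultimately show "inv_into K f ((1 - u) *\<^sub>R y + u *\<^sub>R y') =
      (1 - u) *\<^sub>R inv_into K f y + u *\<^sub>R inv_into K f y'"
    using x assms(3) by (simp add: inv_into_f_f)
qed

section \<open>Affine flows, subflows and extensions\<close>

lemma affine_flowI:
  assumes G: "group G" and T: "topspace T = carrier G"
    and K: "K \<noteq> {}" "compact K" "convex K"
    and closed: "\<And>g x. g \<in> carrier G \<Longrightarrow> x \<in> K \<Longrightarrow> \<alpha> g x \<in> K"
    and one: "\<And>x. x \<in> K \<Longrightarrow> \<alpha> \<one>\<^bsub>G\<^esub> x = x"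
    and mult: "\<And>g h x. g \<in> carrier G \<Longrightarrow> h \<in> carrier G \<Longrightarrow> x \<in> K \<Longrightarrow>
      \<alpha> (g \<otimes>\<^bsub>G\<^esub> h) x = \<alpha> g (\<alpha> h x)"
    and outside: "\<And>g x. g \<in> carrier G \<Longrightarrow> x \<notin> K \<Longrightarrow> \<alpha> g x = undefined"
    and affine: "\<And>g. g \<in> carrier G \<Longrightarrow> affine_map_on K (\<alpha> g)"
    and cont: "continuous_map (prod_topology T (top_of_set K)) euclidean (\<lambda>(g, x). \<alpha> g x)"
  shows "affine_flow G T K \<alpha>"
proof -
  interpret group G by fact
  have Bij: "\<alpha> g \<in> Bij K" if g: "g \<in> carrier G" for g
  proof -
    have "bij_betw (\<alpha> g) K K"
      by (rule bij_betw_byWitness [where f' = "\<alpha> (inv\<^bsub>G\<^esub> g)"])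
        (use g closed one in \<open>auto simp flip: mult\<close>)
    moreover have "\<alpha> g \<in> extensional K"
      using outside g by (simp add: extensional_def)
    ultimately show ?thesis
      by (simp add: Bij_def)
  qed
  have "\<alpha> (g \<otimes>\<^bsub>G\<^esub> h) = compose K (\<alpha> g) (\<alpha> h)" if "g \<in> carrier G" "h \<in> carrier G" for g h
    by (rule ext) (use that mult outside in \<open>auto simp: compose_def\<close>)
  then have "\<alpha> \<in> hom G (BijGroup K)"
    using Bij by (simp add: hom_def BijGroup_def)
  then have "group_action G K \<alpha>"
    by (simp add: group_action_def group_hom_def group_hom_axioms_def group_BijGroup G)
  moreover have "continuous_map (prod_topology T (top_of_set K)) (top_of_set K) (\<lambda>(g, x). \<alpha> g x)"
    using cont closed T by (auto simp: continuous_map_in_subtopology)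
  ultimately show ?thesis
    using K affine by (simp add: affine_flow_def)
qed

context
  fixes G :: "('g, 'm) monoid_scheme" and T :: "'g topology"
    and K :: "'v::locally_convex_t2_space set" and \<alpha> :: "'g \<Rightarrow> 'v \<Rightarrow> 'v"
  assumes flow: "affine_flow G T K \<alpha>"
begin

lemma affine_flow_nonempty: "K \<noteq> {}"
  and affine_flow_compact: "compact K"
  and affine_flow_convex: "convex K"
  and affine_flow_group_action: "group_action G K \<alpha>"
  and affine_flow_affine: "g \<in> carrier G \<Longrightarrow> affine_map_on K (\<alpha> g)"
  using flow by (auto simp: affine_flow_def)

lemma affine_flow_group: "group G"
  using affine_flow_group_action by (simp add: group_action_def group_hom_def)

lemma affine_flow_mem: "g \<in> carrier G \<Longrightarrow> x \<in> K \<Longrightarrow> \<alpha> g x \<in> K"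
  by (rule group_action.element_image [OF affine_flow_group_action _ _ refl])

lemma affine_flow_one: "x \<in> K \<Longrightarrow> \<alpha> \<one>\<^bsub>G\<^esub> x = x"
  by (metis group_action.id_eq_one [OF affine_flow_group_action] restrict_apply')

lemma affine_flow_mult:
  "g \<in> carrier G \<Longrightarrow> h \<in> carrier G \<Longrightarrow> x \<in> K \<Longrightarrow> \<alpha> (g \<otimes>\<^bsub>G\<^esub> h) x = \<alpha> g (\<alpha> h x)"
  by (rule group_action.composition_rule [OF affine_flow_group_action])

lemma affine_flow_continuous_map:
  assumes "continuous_map X T a" "continuous_map X euclidean b" "\<And>z. z \<in> topspace X \<Longrightarrow> b z \<in> K"
  shows "continuous_map X euclidean (\<lambda>z. \<alpha> (a z) (b z))"
proof -
  have "continuous_map (prod_topology T (top_of_set K)) euclidean (\<lambda>(g, x). \<alpha> g x)"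
    using flow by (auto simp: affine_flow_def continuous_map_in_subtopology)
  moreover have "continuous_map X (prod_topology T (top_of_set K)) (\<lambda>z. (a z, b z))"
    using assms by (auto simp: continuous_map_pairwise o_def continuous_map_in_subtopology)
  ultimately have "continuous_map X euclidean ((\<lambda>(g, x). \<alpha> g x) \<circ> (\<lambda>z. (a z, b z)))"
    by (rule continuous_map_compose [rotated])
  then show ?thesis
    by (simp add: o_def)
qed

lemma affine_flow_continuous_on:
  assumes "g \<in> topspace T"
  shows "continuous_on K (\<alpha> g)"
proof -
  have "continuous_map (top_of_set K) euclidean (\<lambda>x. \<alpha> g x)"
    by (rule affine_flow_continuous_map) (use assms in auto)
  then show ?thesis
    by simp
qed

end

lemma affine_flow_restrict:
  assumes flow: "affine_flow G T K \<alpha>" and T: "topspace T = carrier G" and C: "affine_subflow G K \<alpha> C"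
  shows "affine_flow G T C (\<lambda>g. restrict (\<alpha> g) C)"
proof -
  have mem: "\<alpha> g x \<in> C" if "g \<in> carrier G" "x \<in> C" for g x
    using C that by (auto simp: affine_subflow_def)
  have CK: "C \<subseteq> K" "convex C" "closed C" "C \<noteq> {}"
    using C by (auto simp: affine_subflow_def)
  have "group G"
    by (rule affine_flow_group [OF flow])
  show ?thesis
  proof (rule affine_flowI [OF \<open>group G\<close> T])
    show "compact C"
      using compact_Int_closed [OF affine_flow_compact [OF flow] CK(3)] CK(1)
      by (simp add: Int_absorb1)
    show "affine_map_on C (restrict (\<alpha> g) C)" if "g \<in> carrier G" for g
      by (rule affine_map_on_cong [OF CK(2)
            affine_map_on_subset [OF affine_flow_affine [OF flow that] CK(1)]]) simp
    have "continuous_map (prod_topology T (top_of_set C)) euclidean (\<lambda>z. \<alpha> (fst z) (snd z))"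
      by (rule affine_flow_continuous_map [OF flow])
        (use CK(1) in \<open>auto intro: continuous_map_fst continuous_map_into_fulltopology
            [OF continuous_map_snd]\<close>)
    then show "continuous_map (prod_topology T (top_of_set C)) euclidean
        (\<lambda>(g, x). restrict (\<alpha> g) C x)"
      by (rule continuous_map_eq) auto
  qed (use CK mem affine_flow_one [OF flow] affine_flow_mult [OF flow] group.is_monoid [OF \<open>group G\<close>]
      in \<open>auto simp: subset_iff monoid.m_closed\<close>)
qed

lemma affine_G_mapD:
  assumes "affine_G_map G L \<beta> K \<alpha> \<phi>"
  shows "\<phi> ` L \<subseteq> K" "continuous_on L \<phi>" "affine_map_on L \<phi>"
    "\<And>g x. g \<in> carrier G \<Longrightarrow> x \<in> L \<Longrightarrow> \<phi> (\<beta> g x) = \<alpha> g (\<phi> x)"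
    "\<And>x. x \<in> L \<Longrightarrow> \<phi> x \<in> K"
  using assms by (auto simp: affine_G_map_def)

lemma irreducible_extensionD:
  assumes "irreducible_extension G L \<beta> K \<alpha> \<phi>"
  shows "affine_G_map G L \<beta> K \<alpha> \<phi>" "\<phi> ` L = K"
    "\<And>C. affine_subflow G L \<beta> C \<Longrightarrow> \<phi> ` C = K \<Longrightarrow> C = L"
  using assms by (auto simp: irreducible_extension_def affine_extension_def)

lemma irreducible_extensionI:
  assumes "affine_G_map G L \<beta> K \<alpha> \<phi>" "\<phi> ` L = K"
    "\<And>C. affine_subflow G L \<beta> C \<Longrightarrow> \<phi> ` C = K \<Longrightarrow> C = L"
  shows "irreducible_extension G L \<beta> K \<alpha> \<phi>"
  using assms by (auto simp: irreducible_extension_def affine_extension_def)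

lemma affine_G_map_compose:
  assumes "affine_G_map G M \<gamma> L \<beta> \<psi>" "affine_G_map G L \<beta> K \<alpha> \<phi>"
  shows "affine_G_map G M \<gamma> K \<alpha> (\<lambda>x. \<phi> (\<psi> x))"
  unfolding affine_G_map_def
proof (intro conjI)
  show "continuous_on M (\<lambda>x. \<phi> (\<psi> x))"
    by (rule continuous_on_compose2
        [OF affine_G_mapD(2) [OF assms(2)] affine_G_mapD(2) [OF assms(1)] affine_G_mapD(1) [OF assms(1)]])
  show "affine_map_on M (\<lambda>x. \<phi> (\<psi> x))"
    by (rule affine_map_on_compose
        [OF affine_G_mapD(3) [OF assms(1)] affine_G_mapD(3) [OF assms(2)] affine_G_mapD(1) [OF assms(1)]])
qed (use assms in \<open>auto simp: affine_G_map_def\<close>)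

lemma affine_subflow_self: "affine_flow G T K \<alpha> \<Longrightarrow> affine_subflow G K \<alpha> K"
  by (auto simp: affine_subflow_def affine_flow_nonempty affine_flow_convex affine_flow_mem
      intro: compact_imp_closed affine_flow_compact)

lemma affine_subflow_compact: "affine_flow G T K \<alpha> \<Longrightarrow> affine_subflow G K \<alpha> C \<Longrightarrow> compact C"
  using compact_Int_closed [of K C] by (simp add: affine_subflow_def affine_flow_def Int_absorb1)

lemma affine_subflow_image:
  assumes flow: "affine_flow G T M \<gamma>" and map: "affine_G_map G M \<gamma> L \<beta> \<psi>" and C: "affine_subflow G M \<gamma> C"
  shows "affine_subflow G L \<beta> (\<psi> ` C)"
proof -
  note \<psi> = affine_G_mapD [OF map]
  have C': "C \<noteq> {}" "C \<subseteq> M" "convex C" "\<forall>g\<in>carrier G. \<gamma> g ` C \<subseteq> C"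
    using C by (auto simp: affine_subflow_def)
  have "compact (\<psi> ` C)"
    by (rule compact_continuous_image
        [OF continuous_on_subset [OF \<psi>(2) C'(2)] affine_subflow_compact [OF flow C]])
  then have "closed (\<psi> ` C)"
    by (rule compact_imp_closed)
  moreover have "\<beta> g ` \<psi> ` C \<subseteq> \<psi> ` C" if "g \<in> carrier G" for g
    using \<psi>(4) [OF that] C' that by (force simp: image_subset_iff)
  moreover have "\<psi> ` C \<subseteq> L"
    using \<psi>(1) C'(2) by blast
  ultimately show ?thesis
    using C'(1) convex_affine_image [OF \<psi>(3) C'(2,3)] by (auto simp: affine_subflow_def)
qed

lemma irreducible_extension_compose:
  assumes flow: "affine_flow G T M \<gamma>" and \<psi>: "irreducible_extension G M \<gamma> L \<beta> \<psi>"
    and \<phi>: "irreducible_extension G L \<beta> K \<alpha> \<phi>"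
  shows "irreducible_extension G M \<gamma> K \<alpha> (\<lambda>x. \<phi> (\<psi> x))"
proof (rule irreducible_extensionI)
  show "affine_G_map G M \<gamma> K \<alpha> (\<lambda>x. \<phi> (\<psi> x))"
    using irreducible_extensionD(1) [OF \<psi>] irreducible_extensionD(1) [OF \<phi>]
    by (rule affine_G_map_compose)
  show "(\<lambda>x. \<phi> (\<psi> x)) ` M = K"
    using irreducible_extensionD(2) [OF \<psi>] irreducible_extensionD(2) [OF \<phi>]
    by (auto simp flip: image_image)
  fix C assume C: "affine_subflow G M \<gamma> C" "(\<lambda>x. \<phi> (\<psi> x)) ` C = K"
  have "\<psi> ` C = L"
    using affine_subflow_image [OF flow irreducible_extensionD(1) [OF \<psi>] C(1)] C(2)
    by (intro irreducible_extensionD(3) [OF \<phi>]) (simp_all add: image_image)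
  then show "C = M"
    using C(1) by (intro irreducible_extensionD(3) [OF \<psi>])
qed

text \<open>
  The image of \<open>h\<close> is a subflow of \<open>L\<close> that covers \<open>K\<close>, so irreducibility of \<open>L\<close> makes \<open>h\<close> onto;
  a subflow of \<open>N\<close> that covers \<open>L\<close> covers \<open>K\<close>, so irreducibility of \<open>N\<close> makes \<open>h\<close> irreducible.
\<close>
lemma irreducible_extension_over:
  assumes flow: "affine_flow G T N \<gamma>" and N: "irreducible_extension G N \<gamma> K \<alpha> \<psi>"
    and L: "irreducible_extension G L \<beta> K \<alpha> \<phi>"
    and h: "affine_G_map G N \<gamma> L \<beta> h" "\<And>x. x \<in> N \<Longrightarrow> \<phi> (h x) = \<psi> x"
  shows "irreducible_extension G N \<gamma> L \<beta> h"
proof (rule irreducible_extensionI [OF h(1)])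
  show "h ` N = L"
  proof (rule irreducible_extensionD(3) [OF L])
    show "affine_subflow G L \<beta> (h ` N)"
      using flow h(1) affine_subflow_self [OF flow] by (rule affine_subflow_image)
    show "\<phi> ` h ` N = K"
      using h(2) irreducible_extensionD(2) [OF N] by (simp add: image_image)
  qed
  fix C assume C: "affine_subflow G N \<gamma> C" "h ` C = L"
  then have "C \<subseteq> N"
    by (simp add: affine_subflow_def)
  then have "\<psi> ` C = (\<lambda>x. \<phi> (h x)) ` C"
    using h(2) by (intro image_cong) auto
  also have "\<dots> = \<phi> ` h ` C"
    by (simp add: image_image)
  also have "\<dots> = K"
    using C(2) irreducible_extensionD(2) [OF L] by simp
  finally show "C = N"
    using irreducible_extensionD(3) [OF N] C(1) by blast
qed

text \<open>
  Zorn's lemma applies to the subflows that cover \<open>K\<close>: over each point of \<open>K\<close> the members of a chain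
  have nonempty compact fibres, so the intersection of the chain still covers \<open>K\<close>.
\<close>
lemma exists_irreducible_subflow:
  assumes flow: "affine_flow G T P \<gamma>" and \<pi>: "affine_extension G P \<gamma> K \<alpha> \<pi>"
  shows "\<exists>C. affine_subflow G P \<gamma> C \<and> irreducible_extension G C (\<lambda>g. restrict (\<gamma> g) C) K \<alpha> \<pi>"
proof -
  have map: "affine_G_map G P \<gamma> K \<alpha> \<pi>" and onto: "\<pi> ` P = K"
    using \<pi> by (auto simp: affine_extension_def)
  note \<pi>' = affine_G_mapD [OF map]
  define \<F> where "\<F> = {C. affine_subflow G P \<gamma> C \<and> \<pi> ` C = K}"
  obtain C where "C \<in> \<F>" and minimal: "\<And>A. A \<in> \<F> \<Longrightarrow> A \<subseteq> C \<Longrightarrow> A = C"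
  proof (rule minimal_member_chain_Inter)
    show "P \<in> \<F>"
      using affine_subflow_self [OF flow] onto by (simp add: \<F>_def)
    fix \<C> assume \<C>: "\<C> \<noteq> {}" "\<C> \<subseteq> \<F>" "\<And>A B. A \<in> \<C> \<Longrightarrow> B \<in> \<C> \<Longrightarrow> A \<subseteq> B \<or> B \<subseteq> A"
    then have sub: "affine_subflow G P \<gamma> A" "\<pi> ` A = K" if "A \<in> \<C>" for A
      using that by (auto simp: \<F>_def)
    have sub': "A \<subseteq> P" "closed A" "convex A" "\<forall>g\<in>carrier G. \<gamma> g ` A \<subseteq> A" if "A \<in> \<C>" for A
      using sub(1) [OF that] by (auto simp: affine_subflow_def)
    have onto': "y \<in> \<pi> ` \<Inter>\<C>" if y: "y \<in> K" for y
    proof -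
      define fibre where "fibre A = A \<inter> {x \<in> P. \<pi> x = y}" for A
      have "closed {x \<in> P. \<pi> x = y}"
        using \<pi>'(2) compact_imp_closed [OF affine_flow_compact [OF flow]]
        by (rule continuous_closed_preimage_constant)
      then have "compact (fibre A) \<and> fibre A \<noteq> {}" if "A \<in> \<C>" for A
        using affine_subflow_compact [OF flow sub(1) [OF that]] sub(2) [OF that] sub'(1) [OF that] y
        unfolding fibre_def by (blast intro: compact_Int_closed)
      then have "\<Inter>(fibre ` \<C>) \<noteq> {}"
      proof (intro Inter_chain_compact_nonempty)
        fix X Y assume "X \<in> fibre ` \<C>" "Y \<in> fibre ` \<C>"
        then obtain A B where "A \<in> \<C>" "X = fibre A" "B \<in> \<C>" "Y = fibre B"
          by blast
        then show "X \<subseteq> Y \<or> Y \<subseteq> X"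
          using \<C>(3) [of A B] by (auto simp: fibre_def)
      qed (use \<C>(1) in auto)
      then obtain x where "x \<in> \<Inter>(fibre ` \<C>)"
        by blast
      then show ?thesis
        using \<C>(1) by (auto simp: fibre_def)
    qed
    have "\<pi> ` \<Inter>\<C> = K"
      using onto' \<C>(1) sub(2) by blast
    moreover have "K \<noteq> {}"
      using onto affine_flow_nonempty [OF flow] by blast
    moreover have "\<gamma> g ` \<Inter>\<C> \<subseteq> \<Inter>\<C>" if "g \<in> carrier G" for g
      using sub'(4) that by blast
    moreover have "\<Inter>\<C> \<subseteq> P" "closed (\<Inter>\<C>)" "convex (\<Inter>\<C>)"
      using \<C>(1) sub'(1) by blast (use sub'(2,3) in \<open>auto intro: convex_Inter\<close>)
    ultimately show "\<Inter>\<C> \<in> \<F>"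
      unfolding \<F>_def affine_subflow_def by blast
  qed (rule that)
  then have C: "affine_subflow G P \<gamma> C" "\<pi> ` C = K"
    by (auto simp: \<F>_def)
  then have C': "C \<subseteq> P" "\<forall>g\<in>carrier G. \<gamma> g ` C \<subseteq> C"
    by (auto simp: affine_subflow_def)
  have "irreducible_extension G C (\<lambda>g. restrict (\<gamma> g) C) K \<alpha> \<pi>"
  proof (rule irreducible_extensionI [OF _ C(2)])
    show "affine_G_map G C (\<lambda>g. restrict (\<gamma> g) C) K \<alpha> \<pi>"
      using C C' \<pi>' affine_map_on_subset continuous_on_subset
      unfolding affine_G_map_def by (auto simp: subset_iff)
    fix A assume A: "affine_subflow G C (\<lambda>g. restrict (\<gamma> g) C) A" "\<pi> ` A = K"
    then have "A \<subseteq> C"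
      by (simp add: affine_subflow_def)
    moreover from this have "affine_subflow G P \<gamma> A"
      using A(1) C'(1) by (auto simp: affine_subflow_def image_subset_iff subset_iff)
    ultimately show "A = C"
      using A(2) minimal by (simp add: \<F>_def)
  qed
  with C(1) show ?thesis
    by blast
qed

section \<open>Rigidity of maps between irreducible extensions\<close>

lemma closed_Collect_eq_on:
  fixes f g :: "'a::topological_space \<Rightarrow> 'b::t2_space"
  assumes "continuous_on S f" "continuous_on S g" "closed S"
  shows "closed {x \<in> S. f x = g x}"
proof -
  have "continuous_on S (\<lambda>x. (f x, g x))"
    using assms(1,2) by (rule continuous_on_Pair)
  then have "closed (S \<inter> (\<lambda>x. (f x, g x)) -` {y. \<exists>x. y = (x, x)})"
    using assms(3) closed_diagonal by (rule continuous_closed_preimage)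
  also have "S \<inter> (\<lambda>x. (f x, g x)) -` {y. \<exists>x. y = (x, x)} = {x \<in> S. f x = g x}"
    by auto
  finally show ?thesis .
qed

text \<open>
  The mean of \<open>f\<close> and \<open>g\<close> is a map over \<open>K\<close> and therefore onto, so every extreme point of \<open>L'\<close> is a
  midpoint of some \<open>f y\<close> and \<open>g y\<close>, which must then coincide. A point of \<open>L'\<close> outside the image
  under \<open>f\<close> of the set where \<open>f = g\<close> would be separated from that image by a functional whose maximum
  on \<open>L'\<close> is attained at an extreme point.
\<close>
lemma maps_over_irreducible_agree:
  fixes L' :: "'w::locally_convex_t2_space set"
  assumes L: "affine_flow G T L \<beta>" and \<phi>: "irreducible_extension G L \<beta> K \<alpha> \<phi>"
    and L': "affine_flow G T L' \<beta>'" and \<phi>': "irreducible_extension G L' \<beta>' K \<alpha> \<phi>'"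
    and f: "affine_G_map G L \<beta> L' \<beta>' f" "\<And>x. x \<in> L \<Longrightarrow> \<phi>' (f x) = \<phi> x"
    and g: "affine_G_map G L \<beta> L' \<beta>' g" "\<And>x. x \<in> L \<Longrightarrow> \<phi>' (g x) = \<phi> x"
    and x: "x \<in> L"
  shows "f x = g x"
proof -
  (* The coefficients have the shape (1 - t), t of affine_map_on with t = 1/2. *)
  define h where "h x = (1 - 1/2) *\<^sub>R f x + (1/2) *\<^sub>R g x" for x
  note f' = affine_G_mapD [OF f(1)] and g' = affine_G_mapD [OF g(1)]
  have half: "0 \<le> (1/2::real)" "(1/2::real) \<le> 1"
    by auto
  have h_map: "affine_G_map G L \<beta> L' \<beta>' h"
    unfolding affine_G_map_def
  proof (intro conjI ballI)
    show "h ` L \<subseteq> L'"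
      using f'(5) g'(5) half affine_flow_convex [OF L'] unfolding convex_alt h_def by blast
    show "continuous_on L h"
      using f'(2) g'(2) unfolding h_def continuous_on_def
      by (auto intro!: tendsto_add tendsto_scaleR_lc)
    show "affine_map_on L h"
      unfolding affine_map_on_def
    proof (intro ballI)
      fix y z and t :: real assume "y \<in> L" "z \<in> L" "t \<in> {0..1}"
      then have "f ((1 - t) *\<^sub>R y + t *\<^sub>R z) = (1 - t) *\<^sub>R f y + t *\<^sub>R f z"
        "g ((1 - t) *\<^sub>R y + t *\<^sub>R z) = (1 - t) *\<^sub>R g y + t *\<^sub>R g z"
        using affine_map_onD [OF f'(3)] affine_map_onD [OF g'(3)] by auto
      then show "h ((1 - t) *\<^sub>R y + t *\<^sub>R z) = (1 - t) *\<^sub>R h y + t *\<^sub>R h z"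
        unfolding h_def by (simp only:) (simp add: algebra_simps diff_divide_distrib)
    qed
    fix a y assume a: "a \<in> carrier G" "y \<in> L"
    then have "\<beta>' a (h y) = (1 - 1/2) *\<^sub>R \<beta>' a (f y) + (1/2) *\<^sub>R \<beta>' a (g y)"
      unfolding h_def
      by (intro affine_map_onD [OF affine_flow_affine [OF L']] f'(5) g'(5) half)
    then show "h (\<beta> a y) = \<beta>' a (h y)"
      using f'(4) [OF a] g'(4) [OF a] by (simp add: h_def)
  qed
  have h_over: "\<phi>' (h y) = \<phi> y" if y: "y \<in> L" for y
  proof -
    have "\<phi>' (h y) = (1 - 1/2) *\<^sub>R \<phi>' (f y) + (1/2) *\<^sub>R \<phi>' (g y)"
      unfolding h_def
      by (intro affine_map_onD [OF affine_G_mapD(3) [OF irreducible_extensionD(1) [OF \<phi>']]]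
          f'(5) g'(5) y half)
    also have "\<dots> = (1 - 1/2 + 1/2) *\<^sub>R \<phi> y"
      by (simp only: f(2) [OF y] g(2) [OF y] scaleR_left_distrib)
    finally show ?thesis
      by simp
  qed
  have h_onto: "h ` L = L'"
    by (rule irreducible_extensionD(2) [OF irreducible_extension_over [OF L \<phi> \<phi>' h_map h_over]])
  define E where "E = {y \<in> L. f y = g y}"
  have extreme: "e \<in> f ` E" if e: "e extreme_point_of L'" for e
  proof -
    have "e \<in> L'"
      using e by (simp add: extreme_point_of_def)
    then obtain y where y: "y \<in> L" "e = h y"
      using h_onto by blast
    have "f y = g y"
    proof (rule ccontr)
      assume "f y \<noteq> g y"
      then have "e \<in> open_segment (f y) (g y)"
        unfolding y(2) h_def in_segment by (auto intro!: exI [of _ "1/2::real"])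
      then show False
        using e f'(5) g'(5) y(1) by (simp add: extreme_point_of_def)
    qed
    moreover from this have "e = f y"
      unfolding y(2) h_def by (simp flip: scaleR_left_distrib)
    ultimately show ?thesis
      using y(1) by (auto simp: E_def)
  qed
  have "closed E"
    unfolding E_def using f'(2) g'(2) compact_imp_closed [OF affine_flow_compact [OF L]]
    by (rule closed_Collect_eq_on)
  have E_sub: "E \<subseteq> L"
    by (auto simp: E_def)
  have "convex E"
    unfolding convex_alt
  proof (intro ballI allI impI)
    fix a b and u :: real assume ab: "a \<in> E" "b \<in> E" and u: "0 \<le> u \<and> u \<le> 1"
    then have "(1 - u) *\<^sub>R a + u *\<^sub>R b \<in> L"
      using affine_flow_convex [OF L] by (auto simp: convex_alt E_def)
    moreover have "f ((1 - u) *\<^sub>R a + u *\<^sub>R b) = g ((1 - u) *\<^sub>R a + u *\<^sub>R b)"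
      using ab u affine_map_onD [OF f'(3), of a b u] affine_map_onD [OF g'(3), of a b u]
      by (simp add: E_def)
    ultimately show "(1 - u) *\<^sub>R a + u *\<^sub>R b \<in> E"
      by (simp add: E_def)
  qed
  have "compact (f ` E)"
    using compact_Int_closed [OF affine_flow_compact [OF L] \<open>closed E\<close>] E_sub
    by (intro compact_continuous_image continuous_on_subset [OF f'(2)]) (simp_all add: Int_absorb1)
  then have "closed (f ` E)"
    by (rule compact_imp_closed)
  have "convex (f ` E)"
    using f'(3) E_sub \<open>convex E\<close> by (rule convex_affine_image)
  have "y \<in> f ` E" if y: "y \<in> L'" for y
  proof (rule ccontr)
    assume "y \<notin> f ` E"
    then obtain u :: "'w \<Rightarrow> real" where u: "linear u" "continuous_on UNIV u" "\<forall>x\<in>f ` E. u x < u y"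
      using separation_point_closed_convex [OF \<open>closed (f ` E)\<close> \<open>convex (f ` E)\<close>] by blast
    obtain e where e: "e extreme_point_of L'" "\<forall>x\<in>L'. u x \<le> u e"
      using extreme_point_maximizing [OF affine_flow_compact [OF L'] affine_flow_convex [OF L']
          affine_flow_nonempty [OF L'] u(1,2)] by blast
    have "u e < u y" "u y \<le> u e"
      using u(3) extreme [OF e(1)] e(2) y by blast+
    then show False
      by simp
  qed
  then have fE: "f ` E = L'"
    using E_sub f'(5) by blast
  have "affine_subflow G L \<beta> E"
    unfolding affine_subflow_def
  proof (intro conjI ballI)
    show "E \<noteq> {}"
      using fE affine_flow_nonempty [OF L'] by blast
    show "\<beta> a ` E \<subseteq> E" if "a \<in> carrier G" for a
      using f'(4) [OF that] g'(4) [OF that] affine_flow_mem [OF L that] by (auto simp: E_def)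
  qed fact+
  moreover have "\<phi> ` E = \<phi>' ` f ` E"
    unfolding image_image by (rule image_cong) (use f(2) E_sub in auto)
  then have "\<phi> ` E = K"
    using irreducible_extensionD(2) [OF \<phi>'] fE by simp
  ultimately have "E = L"
    by (rule irreducible_extensionD(3) [OF \<phi>])
  with x have "x \<in> E"
    by simp
  then show ?thesis
    by (simp add: E_def)
qed

section \<open>Isomorphic copies of irreducible extensions in a fixed space\<close>

lemma affine_flow_isoD:
  assumes "affine_flow_iso G M \<gamma> N \<delta> \<iota>"
  shows "affine_G_map G M \<gamma> N \<delta> \<iota>" "inj_on \<iota> M" "\<iota> ` M = N"
  using assms by (auto simp: affine_flow_iso_def bij_betw_def)

lemma irreducible_extension_iso:
  assumes "affine_flow_iso G M \<gamma> N \<delta> \<iota>"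
  shows "irreducible_extension G M \<gamma> N \<delta> \<iota>"
proof (rule irreducible_extensionI)
  fix C assume C: "affine_subflow G M \<gamma> C" "\<iota> ` C = N"
  then have "C \<subseteq> M" "\<iota> ` C = \<iota> ` M"
    using affine_flow_isoD(3) [OF assms] by (auto simp: affine_subflow_def)
  then show "C = M"
    using inj_on_image_eq_iff [OF affine_flow_isoD(2) [OF assms]] by blast
qed (use affine_flow_isoD [OF assms] in auto)

lemma affine_flow_iso_inv_into:
  assumes M: "affine_flow G T M \<gamma>" and iso: "affine_flow_iso G M \<gamma> N \<delta> \<iota>"
  shows "affine_flow_iso G N \<delta> M \<gamma> (inv_into M \<iota>)"
proof -
  note \<iota> = affine_flow_isoD [OF iso]
  note \<iota>' = affine_G_mapD [OF \<iota>(1)]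
  have bij: "bij_betw (inv_into M \<iota>) N M"
    using \<iota>(2,3) by (intro bij_betw_inv_into) (simp add: bij_betw_def)
  moreover have "affine_G_map G N \<delta> M \<gamma> (inv_into M \<iota>)"
    unfolding affine_G_map_def
  proof (intro conjI ballI)
    show "inv_into M \<iota> ` N \<subseteq> M"
      using bij by (simp add: bij_betw_def)
    show "continuous_on N (inv_into M \<iota>)"
      unfolding \<iota>(3) [symmetric]
      by (rule continuous_on_inv [OF \<iota>'(2) affine_flow_compact [OF M]]) (simp add: \<iota>(2))
    show "affine_map_on N (inv_into M \<iota>)"
      unfolding \<iota>(3) [symmetric]
      by (rule affine_map_on_inv_into [OF \<iota>'(3) affine_flow_convex [OF M] \<iota>(2)])
    fix g y assume g: "g \<in> carrier G" and "y \<in> N"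
    then obtain x where x: "x \<in> M" "y = \<iota> x"
      using \<iota>(3) by blast
    have "\<delta> g y = \<iota> (\<gamma> g x)"
      unfolding x(2) by (rule \<iota>'(4) [OF g x(1), symmetric])
    then show "inv_into M \<iota> (\<delta> g y) = \<gamma> g (inv_into M \<iota> y)"
      using x \<iota>(2) affine_flow_mem [OF M g x(1)] by simp
  qed
  ultimately show ?thesis
    by (simp add: affine_flow_iso_def)
qed

lemma affine_flow_transport:
  assumes M: "affine_flow G T M \<gamma>" and T: "topspace T = carrier G"
    and \<iota>: "continuous_on M \<iota>" "affine_map_on M \<iota>" "inj_on \<iota> M"
  defines "\<delta> \<equiv> \<lambda>g. restrict (\<lambda>y. \<iota> (\<gamma> g (inv_into M \<iota> y))) (\<iota> ` M)"
  shows "affine_flow G T (\<iota> ` M) \<delta>" "affine_flow_iso G M \<gamma> (\<iota> ` M) \<delta> \<iota>"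
proof -
  note convex = affine_flow_convex [OF M] and mem = affine_flow_mem [OF M]
  have \<delta>: "\<delta> g (\<iota> x) = \<iota> (\<gamma> g x)" if "x \<in> M" for g x
    using that \<iota>(3) by (simp add: \<delta>_def)
  have "group G"
    by (rule affine_flow_group [OF M])
  show "affine_flow G T (\<iota> ` M) \<delta>"
  proof (rule affine_flowI [OF \<open>group G\<close> T])
    show "\<iota> ` M \<noteq> {}"
      using affine_flow_nonempty [OF M] by blast
    show "compact (\<iota> ` M)"
      using \<iota>(1) affine_flow_compact [OF M] by (rule compact_continuous_image)
    show "convex (\<iota> ` M)"
      using \<iota>(2) order_refl convex by (rule convex_affine_image)
    show "\<delta> g y \<in> \<iota> ` M" if "g \<in> carrier G" "y \<in> \<iota> ` M" for g y
      using that \<delta> mem by auto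
    show "\<delta> \<one>\<^bsub>G\<^esub> y = y" if "y \<in> \<iota> ` M" for y
      using that \<delta> affine_flow_one [OF M] by auto
    show "\<delta> (g \<otimes>\<^bsub>G\<^esub> h) y = \<delta> g (\<delta> h y)"
      if "g \<in> carrier G" "h \<in> carrier G" "y \<in> \<iota> ` M" for g h y
      using that \<delta> mem affine_flow_mult [OF M] by auto
    show "\<delta> g y = undefined" if "y \<notin> \<iota> ` M" for g y
      using that by (simp add: \<delta>_def)
    show "affine_map_on (\<iota> ` M) (\<delta> g)" if g: "g \<in> carrier G" for g
    proof (rule affine_map_on_cong)
      have inv: "inv_into M \<iota> ` \<iota> ` M \<subseteq> M"
        by (auto intro: inv_into_into)
      have "affine_map_on M (\<lambda>x. \<iota> (\<gamma> g x))"
        using affine_flow_affine [OF M g] \<iota>(2) by (rule affine_map_on_compose) (use mem g in auto)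
      with affine_map_on_inv_into [OF \<iota>(2) convex \<iota>(3)]
      show "affine_map_on (\<iota> ` M) (\<lambda>y. \<iota> (\<gamma> g (inv_into M \<iota> y)))"
        using inv by (rule affine_map_on_compose)
      show "convex (\<iota> ` M)"
        using \<iota>(2) order_refl convex by (rule convex_affine_image)
    qed (simp add: \<delta>_def)
    show "continuous_map (prod_topology T (top_of_set (\<iota> ` M))) euclidean (\<lambda>(g, y). \<delta> g y)"
      (is "continuous_map ?X _ _")
    proof (rule continuous_map_eq)
      have inv: "continuous_map (top_of_set (\<iota> ` M)) (top_of_set M) (inv_into M \<iota>)"
        using continuous_on_inv [OF \<iota>(1) affine_flow_compact [OF M], of "inv_into M \<iota>"] \<iota>(3)
        by (auto simp: continuous_map_in_subtopology inv_into_into)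
      have "continuous_map ?X (top_of_set M) (\<lambda>z. inv_into M \<iota> (snd z))"
        using continuous_map_compose [OF continuous_map_snd inv] by (simp add: o_def)
      then have "continuous_map ?X euclidean (\<lambda>z. \<gamma> (fst z) (inv_into M \<iota> (snd z)))"
        by (intro affine_flow_continuous_map [OF M] continuous_map_fst)
          (auto simp: continuous_map_in_subtopology inv_into_into)
      moreover have "\<gamma> (fst z) (inv_into M \<iota> (snd z)) \<in> M" if "z \<in> topspace ?X" for z
        using that mem T by (auto simp: inv_into_into)
      ultimately have "continuous_map ?X (top_of_set M) (\<lambda>z. \<gamma> (fst z) (inv_into M \<iota> (snd z)))"
        by (auto simp: continuous_map_in_subtopology)
      moreover have "continuous_map (top_of_set M) euclidean \<iota>"
        using \<iota>(1) by simp
      ultimately show "continuous_map ?X euclidean (\<lambda>z. \<iota> (\<gamma> (fst z) (inv_into M \<iota> (snd z))))"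
        by (rule continuous_map_compose [unfolded o_def])
    qed (auto simp: \<delta>_def)
  qed
  have "affine_G_map G M \<gamma> (\<iota> ` M) \<delta> \<iota>"
    using \<iota> \<delta> by (simp add: affine_G_map_def)
  then show "affine_flow_iso G M \<gamma> (\<iota> ` M) \<delta> \<iota>"
    using \<iota>(3) by (simp add: affine_flow_iso_def bij_betw_def)
qed

lemma continuous_map_real_power:
  fixes f :: "'a \<Rightarrow> 'i real_power"
  shows "continuous_map X euclidean f \<longleftrightarrow> (\<forall>i. continuous_map X euclidean (\<lambda>x. coord (f x) i))"
  unfolding continuous_map_atin limitin_canonical_iff
  by (subst tendsto_real_power_iff) blast

lemma continuous_on_real_power:
  fixes f :: "'a::topological_space \<Rightarrow> 'i real_power"
  shows "continuous_on S f \<longleftrightarrow> (\<forall>i. continuous_on S (\<lambda>x. coord (f x) i))"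
  using continuous_map_real_power [of "top_of_set S" f] by simp

text \<open>
  Fix a section \<open>s\<close> of \<open>\<phi>\<close> and record a continuous affine function \<open>a\<close> on \<open>M\<close> by its trace, the
  values \<open>a (g \<cdot> s x)\<close>. The trace determines \<open>a\<close>: the points \<open>m\<close> such that \<open>a\<close> and \<open>b\<close> agree on the
  orbit of \<open>m\<close> form a subflow, and if the traces of \<open>a\<close> and \<open>b\<close> coincide, it contains all \<open>s x\<close>,
  so it covers \<open>K\<close> and is \<open>M\<close>. The functions on \<open>M\<close> can therefore be indexed by their traces, of
  type \<open>'v \<times> 'g \<Rightarrow> real\<close>, and evaluating all of them embeds \<open>M\<close> because they separate points.
\<close>
lemma irreducible_extension_embeds:
  fixes K :: "'v::locally_convex_t2_space set" and M :: "'w::locally_convex_t2_space set"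
    and \<alpha> :: "'g \<Rightarrow> 'v \<Rightarrow> 'v"
  assumes M: "affine_flow G T M \<gamma>" and T: "topspace T = carrier G"
    and \<phi>: "irreducible_extension G M \<gamma> K \<alpha> \<phi>"
  obtains N :: "('v, 'g) extension_space set" and \<delta> \<iota>
  where "affine_flow G T N \<delta>" "affine_flow_iso G M \<gamma> N \<delta> \<iota>"
proof -
  note \<phi>' = irreducible_extensionD [OF \<phi>]
  note mem = affine_flow_mem [OF M]
  have group: "group G"
    by (rule affine_flow_group [OF M])
  define A where "A = {a :: 'w \<Rightarrow> real. continuous_on M a \<and> affine_map_on M a}"
  define s where "s = inv_into M \<phi>"
  define trace where "trace a = (\<lambda>(x, g). if x \<in> K \<and> g \<in> carrier G then a (\<gamma> g (s x)) else 0)"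
    for a :: "'w \<Rightarrow> real"
  have s: "s x \<in> M" "\<phi> (s x) = x" if "x \<in> K" for x
    using that \<phi>'(2) by (auto simp: s_def inv_into_into f_inv_into_f)
  have trace_inj: "a m = b m" if a: "a \<in> A" and b: "b \<in> A" and eq: "trace a = trace b" and m: "m \<in> M"
    for a b m
  proof -
    define C where "C = {m \<in> M. \<forall>g\<in>carrier G. a (\<gamma> g m) = b (\<gamma> g m)}"
    have C_iff: "m \<in> C \<longleftrightarrow> m \<in> M \<and> (\<forall>g\<in>carrier G. a (\<gamma> g m) = b (\<gamma> g m))" for m
      by (simp add: C_def)
    have "a (\<gamma> g (s x)) = b (\<gamma> g (s x))" if "x \<in> K" "g \<in> carrier G" for x g
      using fun_cong [OF eq, of "(x, g)"] that by (simp add: trace_def)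
    then have sC: "s x \<in> C" if "x \<in> K" for x
      using that s(1) by (simp add: C_iff)
    have "affine_subflow G M \<gamma> C"
      unfolding affine_subflow_def
    proof (intro conjI ballI)
      show "C \<noteq> {}"
        using sC \<phi>'(2) affine_flow_nonempty [OF M] by blast
      show "C \<subseteq> M"
        by (auto simp: C_iff)
      have "closed {m \<in> M. a (\<gamma> g m) = b (\<gamma> g m)}" if g: "g \<in> carrier G" for g
      proof (rule closed_Collect_eq_on)
        have cont: "continuous_on M (\<gamma> g)" and sub: "\<gamma> g ` M \<subseteq> M"
          using affine_flow_continuous_on [OF M] mem g T by auto
        show "continuous_on M (\<lambda>m. a (\<gamma> g m))" "continuous_on M (\<lambda>m. b (\<gamma> g m))"
          using a b by (auto simp: A_def intro: continuous_on_compose2 [OF _ cont sub])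
        show "closed M"
          using affine_flow_compact [OF M] by (rule compact_imp_closed)
      qed
      then have "closed (\<Inter>g\<in>carrier G. {m \<in> M. a (\<gamma> g m) = b (\<gamma> g m)})"
        by blast
      moreover have "C = (\<Inter>g\<in>carrier G. {m \<in> M. a (\<gamma> g m) = b (\<gamma> g m)})"
        using group.is_monoid [OF group, THEN monoid.one_closed] by (auto simp: C_def)
      ultimately show "closed C"
        by simp
      show "convex C"
        unfolding convex_alt
      proof (intro ballI allI impI)
        fix m m' and u :: real assume mm: "m \<in> C" "m' \<in> C" and u: "0 \<le> u \<and> u \<le> 1"
        then have mM: "m \<in> M" "m' \<in> M"
          by (auto simp: C_iff)
        have aff: "c (\<gamma> g ((1 - u) *\<^sub>R m + u *\<^sub>R m')) = (1 - u) *\<^sub>R c (\<gamma> g m) + u *\<^sub>R c (\<gamma> g m')"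
          if "c \<in> A" "g \<in> carrier G" for c g
          using that u mM mem affine_map_onD [OF affine_flow_affine [OF M \<open>g \<in> carrier G\<close>] mM, of u]
            affine_map_onD [of M c "\<gamma> g m" "\<gamma> g m'" u]
          by (simp add: A_def)
        have "a (\<gamma> g ((1 - u) *\<^sub>R m + u *\<^sub>R m')) = b (\<gamma> g ((1 - u) *\<^sub>R m + u *\<^sub>R m'))"
          if "g \<in> carrier G" for g
          using that mm aff [OF a that] aff [OF b that] by (simp add: C_iff)
        moreover have "(1 - u) *\<^sub>R m + u *\<^sub>R m' \<in> M"
          using affine_flow_convex [OF M] mM u by (simp add: convex_alt)
        ultimately show "(1 - u) *\<^sub>R m + u *\<^sub>R m' \<in> C"
          by (simp add: C_iff)
      qed
      show "\<gamma> h ` C \<subseteq> C" if h: "h \<in> carrier G" for h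
      proof
        fix y assume "y \<in> \<gamma> h ` C"
        then obtain m where m: "m \<in> C" "m \<in> M" "y = \<gamma> h m"
          by (auto simp: C_iff)
        have "\<gamma> g y = \<gamma> (g \<otimes>\<^bsub>G\<^esub> h) m" if "g \<in> carrier G" for g
          using affine_flow_mult [OF M that h m(2)] m(3) by simp
        moreover have "g \<otimes>\<^bsub>G\<^esub> h \<in> carrier G" if "g \<in> carrier G" for g
          using that h group.is_monoid [OF group] by (simp add: monoid.m_closed)
        ultimately show "y \<in> C"
          using m mem [OF h] by (simp add: C_iff)
      qed
    qed
    moreover have "\<phi> ` C = K"
    proof
      show "\<phi> ` C \<subseteq> K"
        using \<phi>'(2) by (auto simp: C_iff)
      show "K \<subseteq> \<phi> ` C"
        using sC s(2) by force
    qed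
    ultimately have "C = M"
      by (rule \<phi>'(3))
    then have "a (\<gamma> \<one>\<^bsub>G\<^esub> m) = b (\<gamma> \<one>\<^bsub>G\<^esub> m)"
      using m group.is_monoid [OF group, THEN monoid.one_closed] by (auto simp: C_def)
    then show ?thesis
      using affine_flow_one [OF M m] by simp
  qed
  (* Coordinates that are not the trace of any function are filled with the function 0. *)
  define rep where "rep r = (if r \<in> trace ` A then inv_into A trace r else (\<lambda>m. 0))" for r
  have rep_A: "rep r \<in> A" for r
  proof (cases "r \<in> trace ` A")
    case True
    then show ?thesis
      by (simp add: rep_def inv_into_into)
  qed (simp add: rep_def A_def affine_map_on_def)
  have rep_trace: "rep (trace a) m = a m" if "a \<in> A" "m \<in> M" for a m
  proof (rule trace_inj [OF rep_A that(1) _ that(2)])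
    show "trace (rep (trace a)) = trace a"
      using that(1) by (simp add: rep_def f_inv_into_f)
  qed
  define \<iota> where "\<iota> m = Abs_real_power (\<lambda>r. rep r m)" for m
  have "continuous_on M \<iota>"
    using rep_A by (simp add: continuous_on_real_power \<iota>_def A_def)
  moreover have "affine_map_on M \<iota>"
    unfolding affine_map_on_def
  proof (intro ballI real_power_eqI)
    fix x y and t :: real and r assume "x \<in> M" "y \<in> M" "t \<in> {0..1}"
    then show "coord (\<iota> ((1 - t) *\<^sub>R x + t *\<^sub>R y)) r = coord ((1 - t) *\<^sub>R \<iota> x + t *\<^sub>R \<iota> y) r"
      using affine_map_onD [of M "rep r" x y t] rep_A [of r] by (simp add: \<iota>_def A_def)
  qed
  moreover have "inj_on \<iota> M"
  proof (rule inj_onI, rule ccontr)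
    fix x y assume xy: "x \<in> M" "y \<in> M" "\<iota> x = \<iota> y" "x \<noteq> y"
    then obtain u :: "'w \<Rightarrow> real" where u: "linear u" "continuous_on UNIV u" "u x < u y"
      using separation_point_closed_convex [of "{x}" y] by blast
    have "u \<in> A"
      using u(2) continuous_on_subset affine_map_on_linear [OF u(1)] by (auto simp: A_def)
    moreover have "coord (\<iota> x) (trace u) = coord (\<iota> y) (trace u)"
      using xy(3) by simp
    ultimately have "u x = u y"
      using xy(1,2) rep_trace by (simp add: \<iota>_def)
    then show False
      using u(3) by simp
  qed
  ultimately show thesis
    using affine_flow_transport [OF M T] that by blast
qed

section \<open>Fibre products\<close>

lemma compact_real_power_box:
  fixes X :: "'k \<Rightarrow> real set"
  assumes "\<And>k. compact (X k)"
  shows "compact {z. \<forall>k. coord z k \<in> X k}"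
proof -
  have "compactin (product_topology (\<lambda>k::'k. euclidean) UNIV) (Pi\<^sub>E UNIV X)"
    using assms by (simp add: compactin_PiE)
  then have "compact (Pi\<^sub>E UNIV X)"
    by (simp add: euclidean_product_topology)
  moreover have "continuous_on (Pi\<^sub>E UNIV X) Abs_real_power"
    by (rule continuous_on_subset [OF _ subset_UNIV])
      (simp add: continuous_on_open_vimage open_real_power_def)
  ultimately have "compact (Abs_real_power ` Pi\<^sub>E UNIV X)"
    by (intro compact_continuous_image)
  moreover have "Abs_real_power ` Pi\<^sub>E UNIV X = {z. \<forall>k. coord z k \<in> X k}"
  proof
    show "{z. \<forall>k. coord z k \<in> X k} \<subseteq> Abs_real_power ` Pi\<^sub>E UNIV X"
    proof
      fix z assume "z \<in> {z. \<forall>k. coord z k \<in> X k}"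
      then show "z \<in> Abs_real_power ` Pi\<^sub>E UNIV X"
        by (intro image_eqI [of _ _ "coord z"]) (auto simp: coord_inverse)
    qed
  qed auto
  ultimately show ?thesis
    by simp
qed

definition factor :: "'i \<Rightarrow> ('i \<times> 'j) real_power \<Rightarrow> 'j real_power" where
  "factor i z = Abs_real_power (\<lambda>j. coord z (i, j))"

definition tuple :: "('i \<Rightarrow> 'j real_power) \<Rightarrow> ('i \<times> 'j) real_power" where
  "tuple f = Abs_real_power (\<lambda>(i, j). coord (f i) j)"

lemma coord_factor [simp]: "coord (factor i z) j = coord z (i, j)"
  by (simp add: factor_def)

lemma coord_tuple [simp]: "coord (tuple f) (i, j) = coord (f i) j"
  by (simp add: tuple_def)

lemma factor_tuple [simp]: "factor i (tuple f) = f i"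
  by (rule real_power_eqI) simp

lemma tuple_eqI: "(\<And>i. f i = factor i z) \<Longrightarrow> tuple f = z"
  by (rule real_power_eqI) (auto simp: tuple_def split: prod.split)

lemma linear_factor: "linear (factor i)"
  by (intro linearI real_power_eqI) simp_all

lemma continuous_map_coord: "continuous_map X euclidean f \<Longrightarrow> continuous_map X euclidean (\<lambda>x. coord (f x) k)"
  by (simp add: continuous_map_real_power)

lemma continuous_on_factor: "continuous_on S (factor i)"
  using continuous_map_coord [of "top_of_set S" "\<lambda>z. z"] by (simp add: continuous_on_real_power)

text \<open>
  The fibre product consists of the points all of whose factors lie over the same point of \<open>K\<close>. It is
  compact by Tychonoff's theorem, and it covers \<open>K\<close> since the factors of a point can be chosen
  independently in the fibres. As a type of indices is never empty, \<open>undefined\<close> serves as the index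
  through which the projection to \<open>K\<close> is defined.
\<close>
lemma fibre_product:
  fixes N :: "'i \<Rightarrow> 'j real_power set" and K :: "'v::locally_convex_t2_space set"
  assumes T: "topspace T = carrier G"
    and N: "\<And>i. affine_flow G T (N i) (\<gamma> i)"
    and \<phi>: "\<And>i. affine_extension G (N i) (\<gamma> i) K \<alpha> (\<phi> i)"
  obtains P \<delta> \<pi> where "affine_flow G T P \<delta>" "affine_extension G P \<delta> K \<alpha> \<pi>"
    "\<And>i. affine_G_map G P \<delta> (N i) (\<gamma> i) (factor i)"
    "\<And>i z. z \<in> P \<Longrightarrow> \<phi> i (factor i z) = \<pi> z"
proof -
  have map: "affine_G_map G (N i) (\<gamma> i) K \<alpha> (\<phi> i)" and onto: "\<phi> i ` N i = K" for i
    using \<phi> by (auto simp: affine_extension_def)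
  note \<phi>' = affine_G_mapD [OF map]
  note mem = affine_flow_mem [OF N]
  have "group G"
    by (rule affine_flow_group [OF N])
  define B where "B = {z. \<forall>i. factor i z \<in> N i}"
  define P where "P = {z \<in> B. \<forall>i i'. \<phi> i (factor i z) = \<phi> i' (factor i' z)}"
  define \<pi> where "\<pi> z = \<phi> undefined (factor (undefined :: 'i) z)" for z
  define \<delta> where "\<delta> g = restrict (\<lambda>z. tuple (\<lambda>i. \<gamma> i g (factor i z))) P" for g
  have P_N: "factor i z \<in> N i" if "z \<in> P" for z i
    using that by (auto simp: P_def B_def)
  have P_\<pi>: "\<phi> i (factor i z) = \<pi> z" if "z \<in> P" for z i
    unfolding \<pi>_def using that by (auto simp: P_def)
  have P_I: "z \<in> P" if "\<And>i. factor i z \<in> N i" "\<And>i. \<phi> i (factor i z) = y" for z y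
    using that by (auto simp: P_def B_def)
  have combine: "factor i ((1 - t) *\<^sub>R z + t *\<^sub>R z') = (1 - t) *\<^sub>R factor i z + t *\<^sub>R factor i z'" for i t z z'
    by (rule real_power_eqI) simp
  have closed_B: "closed B"
  proof -
    have "closed (factor i -` N i)" for i
      using affine_flow_compact [OF N] continuous_on_factor
      by (intro closed_vimage compact_imp_closed)
    then have "closed (\<Inter>i. factor i -` N i)"
      by blast
    moreover have "(\<Inter>i. factor i -` N i) = B"
      by (auto simp: B_def)
    ultimately show ?thesis
      by simp
  qed
  have "compact {z. \<forall>k. coord z k \<in> (\<lambda>y. coord y (snd k)) ` N (fst k)}"
  proof (rule compact_real_power_box)
    fix k :: "'i \<times> 'j"
    have "continuous_on (N (fst k)) (\<lambda>y. coord y (snd k))"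
      using continuous_map_coord [of "top_of_set (N (fst k))" "\<lambda>z. z"] by simp
    then show "compact ((\<lambda>y. coord y (snd k)) ` N (fst k))"
      using affine_flow_compact [OF N] by (rule compact_continuous_image)
  qed
  then have "compact ({z. \<forall>k. coord z k \<in> (\<lambda>y. coord y (snd k)) ` N (fst k)} \<inter> B)"
    using closed_B by (rule compact_Int_closed)
  moreover have "B \<subseteq> {z. \<forall>k. coord z k \<in> (\<lambda>y. coord y (snd k)) ` N (fst k)}"
  proof
    fix z assume "z \<in> B"
    then have "coord z k \<in> (\<lambda>y. coord y (snd k)) ` N (fst k)" for k
      by (intro image_eqI [of _ _ "factor (fst k) z"]) (auto simp: B_def)
    then show "z \<in> {z. \<forall>k. coord z k \<in> (\<lambda>y. coord y (snd k)) ` N (fst k)}"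
      by blast
  qed
  ultimately have "compact B"
    by (simp add: Int_absorb1)
  have "closed {z \<in> B. \<phi> i (factor i z) = \<phi> i' (factor i' z)}" for i i'
  proof (rule closed_Collect_eq_on [OF _ _ closed_B])
    show "continuous_on B (\<lambda>z. \<phi> i (factor i z))" for i
      by (rule continuous_on_compose2 [OF \<phi>'(2) continuous_on_factor]) (auto simp: B_def)
    then show "continuous_on B (\<lambda>z. \<phi> i' (factor i' z))" .
  qed
  then have "closed (\<Inter>i. \<Inter>i'. {z \<in> B. \<phi> i (factor i z) = \<phi> i' (factor i' z)})"
    by blast
  with \<open>compact B\<close> have "compact (B \<inter> (\<Inter>i. \<Inter>i'. {z \<in> B. \<phi> i (factor i z) = \<phi> i' (factor i' z)}))"
    by (rule compact_Int_closed)
  moreover have "B \<inter> (\<Inter>i. \<Inter>i'. {z \<in> B. \<phi> i (factor i z) = \<phi> i' (factor i' z)}) = P"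
    by (auto simp: P_def)
  ultimately have compact: "compact P"
    by simp
  have convex: "convex P"
    unfolding convex_alt
  proof (intro ballI allI impI)
    fix z z' and t :: real assume z: "z \<in> P" "z' \<in> P" and t: "0 \<le> t \<and> t \<le> 1"
    show "(1 - t) *\<^sub>R z + t *\<^sub>R z' \<in> P"
    proof (rule P_I)
      fix i
      show "factor i ((1 - t) *\<^sub>R z + t *\<^sub>R z') \<in> N i"
        unfolding combine using affine_flow_convex [OF N, of i] P_N z t by (simp add: convex_alt)
      show "\<phi> i (factor i ((1 - t) *\<^sub>R z + t *\<^sub>R z')) = (1 - t) *\<^sub>R \<pi> z + t *\<^sub>R \<pi> z'"
        unfolding combine
        using affine_map_onD [OF \<phi>'(3) P_N P_N, of z z' t i] P_\<pi> z t by simp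
    qed
  qed
  have lift: "\<exists>z\<in>P. \<pi> z = y" if "y \<in> K" for y
  proof -
    have "\<exists>x\<in>N i. \<phi> i x = y" for i
      using onto [of i] that by blast
    then obtain f where "\<And>i. f i \<in> N i \<and> \<phi> i (f i) = y"
      by metis
    then have "tuple f \<in> P"
      by (intro P_I [of _ y]) simp_all
    with \<open>\<And>i. f i \<in> N i \<and> \<phi> i (f i) = y\<close> show ?thesis
      by (intro bexI [of _ "tuple f"]) (simp add: \<pi>_def)
  qed
  have factor_\<delta>: "factor i (\<delta> g z) = \<gamma> i g (factor i z)" if "z \<in> P" for i g z
    using that by (simp add: \<delta>_def)
  have \<delta>_mem: "\<delta> g z \<in> P" if "g \<in> carrier G" "z \<in> P" for g z
    using that by (intro P_I [of _ "\<alpha> g (\<pi> z)"]) (simp_all add: factor_\<delta> mem P_N \<phi>'(4) P_\<pi>)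
  have eqI: "z = z'" if "\<And>i. factor i z = factor i z'" for z z' :: "('i \<times> 'j) real_power"
    using tuple_eqI [of "\<lambda>i. factor i z" z] tuple_eqI [of "\<lambda>i. factor i z" z'] that by simp
  have flow: "affine_flow G T P \<delta>"
  proof (rule affine_flowI [OF \<open>group G\<close> T _ compact convex \<delta>_mem])
    have "K \<noteq> {}"
      using onto affine_flow_nonempty [OF N] by blast
    then show "P \<noteq> {}"
      using lift by blast
    show "\<delta> \<one>\<^bsub>G\<^esub> z = z" if "z \<in> P" for z
      by (rule eqI) (simp add: that factor_\<delta> affine_flow_one [OF N] P_N)
    show "\<delta> (g \<otimes>\<^bsub>G\<^esub> h) z = \<delta> g (\<delta> h z)" if "g \<in> carrier G" "h \<in> carrier G" "z \<in> P" for g h z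
      by (rule eqI) (simp add: that factor_\<delta> \<delta>_mem affine_flow_mult [OF N] P_N)
    show "\<delta> g z = undefined" if "z \<notin> P" for g z
      using that by (simp add: \<delta>_def)
    show "affine_map_on P (\<delta> g)" if g: "g \<in> carrier G" for g
      unfolding affine_map_on_def
    proof (intro ballI eqI)
      fix z z' and t :: real and i assume z: "z \<in> P" "z' \<in> P" and t: "t \<in> {0..1}"
      have "(1 - t) *\<^sub>R z + t *\<^sub>R z' \<in> P"
        using convex z t by (simp add: convex_alt)
      then show "factor i (\<delta> g ((1 - t) *\<^sub>R z + t *\<^sub>R z')) = factor i ((1 - t) *\<^sub>R \<delta> g z + t *\<^sub>R \<delta> g z')"
        using affine_map_onD [OF affine_flow_affine [OF N g] P_N P_N, of z z' t i] z t
        by (simp add: factor_\<delta> combine)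
    qed
    show "continuous_map (prod_topology T (top_of_set P)) euclidean (\<lambda>(g, z). \<delta> g z)"
      (is "continuous_map ?X _ _")
    proof (rule continuous_map_eq)
      have snd: "continuous_map ?X euclidean (\<lambda>x. snd x)"
        using continuous_map_snd by (rule continuous_map_into_fulltopology)
      have "continuous_map ?X euclidean (\<lambda>x. \<gamma> i (fst x) (factor i (snd x)))" for i
      proof (rule affine_flow_continuous_map [OF N continuous_map_fst])
        show "continuous_map ?X euclidean (\<lambda>x. factor i (snd x))"
          unfolding continuous_map_real_power coord_factor
          using continuous_map_coord [OF snd] by blast
        show "factor i (snd x) \<in> N i" if "x \<in> topspace ?X" for x
          using that P_N by auto
      qed
      from continuous_map_coord [OF this]
      show "continuous_map ?X euclidean (\<lambda>x. tuple (\<lambda>i. \<gamma> i (fst x) (factor i (snd x))))"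
        by (subst continuous_map_real_power) (simp add: tuple_def split: prod.split)
    qed (auto simp: \<delta>_def)
  qed
  have factor_map: "affine_G_map G P \<delta> (N i) (\<gamma> i) (factor i)" for i
    unfolding affine_G_map_def
    using P_N factor_\<delta> by (auto simp: continuous_on_factor affine_map_on_linear linear_factor)
  have "affine_G_map G P \<delta> K \<alpha> \<pi>"
    unfolding \<pi>_def using affine_G_map_compose [OF factor_map map] .
  moreover have "\<pi> ` P = K"
    using lift affine_G_mapD(1) [OF calculation] by blast
  ultimately have "affine_extension G P \<delta> K \<alpha> \<pi>"
    by (simp add: affine_extension_def)
  then show thesis
    using that flow factor_map P_\<pi> by blast
qed

section \<open>Projective irreducible extensions\<close>

text \<open>
  The extensions \<open>N\<close> to be reached range over the flows in one space \<open>'u\<close>, given as an argument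
  because a formula cannot quantify over types.
\<close>
definition projective_irreducible_extension ::
  "'u::locally_convex_t2_space itself \<Rightarrow> ('g, 'm) monoid_scheme \<Rightarrow> 'g topology \<Rightarrow>
    'w::locally_convex_t2_space set \<Rightarrow> ('g \<Rightarrow> 'w \<Rightarrow> 'w) \<Rightarrow>
    'v::locally_convex_t2_space set \<Rightarrow> ('g \<Rightarrow> 'v \<Rightarrow> 'v) \<Rightarrow> ('v \<Rightarrow> 'w) \<Rightarrow> bool" where
  "projective_irreducible_extension (_ :: 'u itself) G T K \<alpha> L \<beta> \<phi> \<longleftrightarrow>
     affine_flow G T L \<beta> \<and> irreducible_extension G L \<beta> K \<alpha> \<phi> \<and>
     (\<forall>(N :: 'u set) \<delta> \<psi>. affine_flow G T N \<delta> \<and> irreducible_extension G N \<delta> K \<alpha> \<psi> \<longrightarrow>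
       (\<exists>p. affine_G_map G L \<beta> N \<delta> p \<and> (\<forall>x\<in>L. \<psi> (p x) = \<phi> x)))"

lemma irreducible_extension_refl:
  assumes "affine_flow G T K \<alpha>"
  shows "irreducible_extension G K \<alpha> K \<alpha> (\<lambda>x. x)"
  by (rule irreducible_extension_iso)
    (simp add: affine_flow_iso_def affine_G_map_def affine_map_on_def bij_betw_def)

lemma affine_G_map_restrict:
  assumes "affine_G_map G P \<delta> N \<gamma> p" "affine_subflow G P \<delta> C"
  shows "affine_G_map G C (\<lambda>g. restrict (\<delta> g) C) N \<gamma> p"
  unfolding affine_G_map_def
proof (intro conjI ballI)
  note p = affine_G_mapD [OF assms(1)]
  have C: "C \<subseteq> P"
    using assms(2) by (simp add: affine_subflow_def)
  show "p ` C \<subseteq> N"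
    using p(1) C by blast
  show "continuous_on C p"
    using p(2) C by (rule continuous_on_subset)
  show "affine_map_on C p"
    using p(3) C by (rule affine_map_on_subset)
  show "p (restrict (\<delta> g) C x) = \<gamma> g (p x)" if "g \<in> carrier G" "x \<in> C" for g x
    using p(4) [OF that(1) subsetD [OF C that(2)]] that(2) by simp
qed

text \<open>
  The family of all irreducible extensions of \<open>K\<close> in \<open>('v, 'g) extension_space\<close> is indexed by its own
  members \<open>(N, \<delta>, \<psi>)\<close>. A minimal subflow of its fibre product lives in a larger space, but it is an
  irreducible extension of \<open>K\<close> and so has a copy in \<open>('v, 'g) extension_space\<close> again.
\<close>
lemma exists_projective_irreducible_extension:
  fixes K :: "'v::locally_convex_t2_space set" and \<alpha> :: "'g \<Rightarrow> 'v \<Rightarrow> 'v"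
  assumes K: "affine_flow G T K \<alpha>" and T: "topspace T = carrier G"
  obtains L :: "('v, 'g) extension_space set" and \<beta> \<phi>
  where "projective_irreducible_extension TYPE(('v, 'g) extension_space) G T K \<alpha> L \<beta> \<phi>"
proof -
  define good where "good = (\<lambda>(N :: ('v, 'g) extension_space set, \<delta>, \<psi>).
    affine_flow G T N \<delta> \<and> irreducible_extension G N \<delta> K \<alpha> \<psi>)"
  obtain N :: "('v, 'g) extension_space set" and \<delta> \<iota>
    where N: "affine_flow G T N \<delta>" "affine_flow_iso G K \<alpha> N \<delta> \<iota>"
    using irreducible_extension_embeds [OF K T irreducible_extension_refl [OF K]] by blast
  define i0 where "i0 = (N, \<delta>, inv_into K \<iota>)"
  have "good i0"
    using N(1) irreducible_extension_iso [OF affine_flow_iso_inv_into [OF K N(2)]]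
    by (simp add: good_def i0_def)
  (* Triples that are not irreducible extensions get the default i0, a copy of K over itself, so
     that the whole type of triples can serve as the index type. *)
  define valid where "valid i = (if good i then i else i0)" for i
  have "good (valid i)" for i
    using \<open>good i0\<close> by (simp add: valid_def)
  then have valid: "affine_flow G T (fst (valid i)) (fst (snd (valid i)))"
    "irreducible_extension G (fst (valid i)) (fst (snd (valid i))) K \<alpha> (snd (snd (valid i)))" for i
    by (auto simp: good_def split_beta)
  have ext: "affine_extension G (fst (valid i)) (fst (snd (valid i))) K \<alpha> (snd (snd (valid i)))" for i
    using valid(2) by (simp add: irreducible_extension_def)
  obtain P \<eta> \<pi> where P: "affine_flow G T P \<eta>" "affine_extension G P \<eta> K \<alpha> \<pi>"
    "\<And>i. affine_G_map G P \<eta> (fst (valid i)) (fst (snd (valid i))) (factor i)"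
    "\<And>i z. z \<in> P \<Longrightarrow> snd (snd (valid i)) (factor i z) = \<pi> z"
    using fibre_product [of T G "\<lambda>i. fst (valid i)" "\<lambda>i. fst (snd (valid i))" K \<alpha> "\<lambda>i. snd (snd (valid i))",
        OF T valid(1) ext] by blast
  obtain C where C: "affine_subflow G P \<eta> C"
    "irreducible_extension G C (\<lambda>g. restrict (\<eta> g) C) K \<alpha> \<pi>"
    using exists_irreducible_subflow [OF P(1,2)] by blast
  have flow_C: "affine_flow G T C (\<lambda>g. restrict (\<eta> g) C)"
    using P(1) T C(1) by (rule affine_flow_restrict)
  obtain L :: "('v, 'g) extension_space set" and \<beta> \<iota>
    where L: "affine_flow G T L \<beta>" "affine_flow_iso G C (\<lambda>g. restrict (\<eta> g) C) L \<beta> \<iota>"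
    using irreducible_extension_embeds [OF flow_C T C(2)] by blast
  define \<kappa> where "\<kappa> = inv_into C \<iota>"
  have \<kappa>: "affine_flow_iso G L \<beta> C (\<lambda>g. restrict (\<eta> g) C) \<kappa>"
    unfolding \<kappa>_def using flow_C L(2) by (rule affine_flow_iso_inv_into)
  have "C \<subseteq> P"
    using C(1) by (simp add: affine_subflow_def)
  have \<kappa>_mem: "\<kappa> x \<in> P" if "x \<in> L" for x
    using affine_flow_isoD(3) [OF \<kappa>] \<open>C \<subseteq> P\<close> that by blast
  have irr: "irreducible_extension G L \<beta> K \<alpha> (\<lambda>x. \<pi> (\<kappa> x))"
    using L(1) irreducible_extension_iso [OF \<kappa>] C(2) by (rule irreducible_extension_compose)
  have "\<exists>p. affine_G_map G L \<beta> N' \<delta>' p \<and> (\<forall>x\<in>L. \<psi> (p x) = \<pi> (\<kappa> x))"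
    if "affine_flow G T N' \<delta>'" "irreducible_extension G N' \<delta>' K \<alpha> \<psi>"
    for N' :: "('v, 'g) extension_space set" and \<delta>' \<psi>
  proof -
    define i where "i = (N', \<delta>', \<psi>)"
    have i: "valid i = (N', \<delta>', \<psi>)"
      using that by (simp add: valid_def good_def i_def)
    have "affine_G_map G C (\<lambda>g. restrict (\<eta> g) C) N' \<delta>' (factor i)"
      using affine_G_map_restrict [OF P(3) [of i] C(1)] i by simp
    with affine_flow_isoD(1) [OF \<kappa>]
    have "affine_G_map G L \<beta> N' \<delta>' (\<lambda>x. factor i (\<kappa> x))"
      by (rule affine_G_map_compose)
    moreover have "\<psi> (factor i (\<kappa> x)) = \<pi> (\<kappa> x)" if "x \<in> L" for x
      using P(4) [OF \<kappa>_mem [OF that], of i] i by simp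
    ultimately show ?thesis
      by blast
  qed
  with L(1) irr
  have "projective_irreducible_extension TYPE(('v, 'g) extension_space) G T K \<alpha> L \<beta> (\<lambda>x. \<pi> (\<kappa> x))"
    by (simp add: projective_irreducible_extension_def)
  then show thesis
    by (rule that)
qed

lemma projective_irreducible_extension_any_space:
  fixes K :: "'v::locally_convex_t2_space set" and \<alpha> :: "'g \<Rightarrow> 'v \<Rightarrow> 'v"
  assumes T: "topspace T = carrier G"
    and L: "projective_irreducible_extension TYPE(('v, 'g) extension_space) G T K \<alpha> L \<beta> \<phi>"
  shows "projective_irreducible_extension TYPE('w::locally_convex_t2_space) G T K \<alpha> L \<beta> \<phi>"
proof -
  have "\<exists>p. affine_G_map G L \<beta> M \<gamma> p \<and> (\<forall>x\<in>L. \<psi> (p x) = \<phi> x)"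
    if M: "affine_flow G T M \<gamma>" and \<psi>: "irreducible_extension G M \<gamma> K \<alpha> \<psi>"
    for M :: "'w set" and \<gamma> \<psi>
  proof -
    obtain N :: "('v, 'g) extension_space set" and \<delta> \<iota>
      where N: "affine_flow G T N \<delta>" "affine_flow_iso G M \<gamma> N \<delta> \<iota>"
      using irreducible_extension_embeds [OF M T \<psi>] by blast
    note inv = affine_flow_iso_inv_into [OF M N(2)]
    have "irreducible_extension G N \<delta> K \<alpha> (\<lambda>x. \<psi> (inv_into M \<iota> x))"
      using N(1) irreducible_extension_iso [OF inv] \<psi> by (rule irreducible_extension_compose)
    with N(1) L obtain p where p: "affine_G_map G L \<beta> N \<delta> p"
      "\<forall>x\<in>L. \<psi> (inv_into M \<iota> (p x)) = \<phi> x"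
      unfolding projective_irreducible_extension_def by blast
    have "affine_G_map G L \<beta> M \<gamma> (\<lambda>x. inv_into M \<iota> (p x))"
      using p(1) affine_flow_isoD(1) [OF inv] by (rule affine_G_map_compose)
    with p(2) show ?thesis
      by blast
  qed
  with L show ?thesis
    by (simp add: projective_irreducible_extension_def)
qed

text \<open>
  An irreducible \<open>\<psi> : M \<rightarrow> L\<close> admits a map \<open>p : L \<rightarrow> M\<close> over \<open>K\<close>, which is onto because \<open>M\<close> is
  irreducible over \<open>K\<close>. By rigidity \<open>\<psi> \<circ> p\<close> is the identity, so \<open>\<psi>\<close> is injective.
\<close>
lemma projective_imp_no_nontrivial_irreducible_extension:
  assumes L: "projective_irreducible_extension TYPE('u::locally_convex_t2_space) G T K \<alpha> L \<beta> \<phi>"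
  shows "no_nontrivial_irreducible_extension TYPE('u) G T L \<beta>"
  unfolding no_nontrivial_irreducible_extension_def
proof (intro allI impI, elim conjE)
  fix M :: "'u set" and \<gamma> \<psi>
  assume M: "affine_flow G T M \<gamma>" and \<psi>: "irreducible_extension G M \<gamma> L \<beta> \<psi>"
  have flow: "affine_flow G T L \<beta>" and \<phi>: "irreducible_extension G L \<beta> K \<alpha> \<phi>"
    using L by (auto simp: projective_irreducible_extension_def)
  have \<phi>\<psi>: "irreducible_extension G M \<gamma> K \<alpha> (\<lambda>x. \<phi> (\<psi> x))"
    using M \<psi> \<phi> by (rule irreducible_extension_compose)
  with L M obtain p where p: "affine_G_map G L \<beta> M \<gamma> p" "\<And>x. x \<in> L \<Longrightarrow> \<phi> (\<psi> (p x)) = \<phi> x"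
    unfolding projective_irreducible_extension_def by blast
  have "p ` L = M"
    using irreducible_extension_over [OF flow \<phi> \<phi>\<psi> p] by (rule irreducible_extensionD(2))
  have retraction: "\<psi> (p x) = x" if "x \<in> L" for x
    by (rule maps_over_irreducible_agree [OF flow \<phi> flow \<phi> _ p(2) _ _ that])
      (use affine_G_map_compose [OF p(1) irreducible_extensionD(1) [OF \<psi>]]
        irreducible_extensionD(1) [OF irreducible_extension_refl [OF flow]] in simp_all)
  have "inj_on \<psi> M"
    unfolding \<open>p ` L = M\<close> [symmetric] by (rule inj_onI) (auto simp: retraction)
  then show "affine_flow_iso G M \<gamma> L \<beta> \<psi>"
    using irreducible_extensionD(1,2) [OF \<psi>] by (simp add: affine_flow_iso_def bij_betw_def)
qed

text \<open>
  The map over \<open>K\<close> that projectivity provides is an irreducible extension of the maximal flow \<open>L'\<close>.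
\<close>
lemma projective_iso_maximal:
  fixes L :: "'u::locally_convex_t2_space set" and L' :: "'w::locally_convex_t2_space set"
  assumes L: "projective_irreducible_extension TYPE('w) G T K \<alpha> L \<beta> \<phi>"
    and L': "maximal_irreducible_over TYPE('u) G T K \<alpha> L' \<beta>'"
  obtains p where "affine_flow_iso G L \<beta> L' \<beta>' p"
proof -
  obtain \<psi> where \<psi>: "affine_flow G T L' \<beta>'" "irreducible_extension G L' \<beta>' K \<alpha> \<psi>"
    and max: "no_nontrivial_irreducible_extension TYPE('u) G T L' \<beta>'"
    using L' by (auto simp: maximal_irreducible_over_def)
  have flow: "affine_flow G T L \<beta>" and \<phi>: "irreducible_extension G L \<beta> K \<alpha> \<phi>"
    using L by (auto simp: projective_irreducible_extension_def)
  obtain p where p: "affine_G_map G L \<beta> L' \<beta>' p" "\<And>x. x \<in> L \<Longrightarrow> \<psi> (p x) = \<phi> x"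
    using L \<psi> unfolding projective_irreducible_extension_def by blast
  have "irreducible_extension G L \<beta> L' \<beta>' p"
    by (rule irreducible_extension_over [OF flow \<phi> \<psi>(2) p])
  with max flow have "affine_flow_iso G L \<beta> L' \<beta>' p"
    by (simp add: no_nontrivial_irreducible_extension_def)
  then show thesis
    by (rule that)
qed

lemma no_nontrivial_irreducible_extension_iso:
  assumes L: "affine_flow G T L \<beta>" "no_nontrivial_irreducible_extension TYPE('u::locally_convex_t2_space) G T L \<beta>"
    and p: "affine_flow_iso G L \<beta> L' \<beta>' p"
  shows "no_nontrivial_irreducible_extension TYPE('u) G T L' \<beta>'"
  unfolding no_nontrivial_irreducible_extension_def
proof (intro allI impI, elim conjE)
  fix M :: "'u set" and \<gamma> \<psi>
  assume M: "affine_flow G T M \<gamma>" and \<psi>: "irreducible_extension G M \<gamma> L' \<beta>' \<psi>"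
  have "irreducible_extension G M \<gamma> L \<beta> (\<lambda>x. inv_into L p (\<psi> x))"
    using M \<psi> irreducible_extension_iso [OF affine_flow_iso_inv_into [OF L(1) p]]
    by (rule irreducible_extension_compose)
  with L(2) M have "affine_flow_iso G M \<gamma> L \<beta> (\<lambda>x. inv_into L p (\<psi> x))"
    by (simp add: no_nontrivial_irreducible_extension_def)
  then have "inj_on \<psi> M"
    by (auto simp: affine_flow_iso_def bij_betw_def inj_on_def)
  then show "affine_flow_iso G M \<gamma> L' \<beta>' \<psi>"
    using irreducible_extensionD(1,2) [OF \<psi>] by (simp add: affine_flow_iso_def bij_betw_def)
qed

section \<open>The universal irreducible extension\<close>

theorem theorem4p15:
  fixes G :: "('g, 'm) monoid_scheme" and T :: "'g topology"
    and K :: "'v::locally_convex_t2_space set" and \<alpha> :: "'g \<Rightarrow> 'v \<Rightarrow> 'v"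
  assumes "polish_group G T" and "affine_flow G T K \<alpha>"
  shows
    "(\<exists>(L :: ('v, 'g) extension_space set) \<beta>.
        maximal_irreducible_over TYPE(('v, 'g) extension_space) G T K \<alpha> L \<beta>) \<and>
     (\<forall>(L :: 'a::locally_convex_t2_space set) \<beta>.
        maximal_irreducible_over TYPE(('v, 'g) extension_space) G T K \<alpha> L \<beta> \<longrightarrow>
        maximal_irreducible_over TYPE('b::locally_convex_t2_space) G T K \<alpha> L \<beta>) \<and>
     (\<forall>(L :: 'a set) \<beta> (L' :: 'b set) \<beta>'.
        maximal_irreducible_over TYPE(('v, 'g) extension_space) G T K \<alpha> L \<beta> \<and>
        maximal_irreducible_over TYPE(('v, 'g) extension_space) G T K \<alpha> L' \<beta>' \<longrightarrow>
        (\<exists>\<theta>. affine_flow_iso G L \<beta> L' \<beta>' \<theta>))"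
proof -
  have T: "topspace T = carrier G"
    using assms(1) by (simp add: polish_group_def)
  obtain P :: "('v, 'g) extension_space set" and \<eta> \<phi>
    where P: "projective_irreducible_extension TYPE(('v, 'g) extension_space) G T K \<alpha> P \<eta> \<phi>"
    using exists_projective_irreducible_extension [OF assms(2) T] by blast
  have flow: "affine_flow G T P \<eta>" and irr: "irreducible_extension G P \<eta> K \<alpha> \<phi>"
    using P by (auto simp: projective_irreducible_extension_def)
  have P_a: "projective_irreducible_extension TYPE('a) G T K \<alpha> P \<eta> \<phi>"
    using T P by (rule projective_irreducible_extension_any_space)
  have P_b: "projective_irreducible_extension TYPE('b) G T K \<alpha> P \<eta> \<phi>"
    using T P by (rule projective_irreducible_extension_any_space)
  show ?thesis
  proof (intro conjI allI impI, goal_cases)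
    case 1
    show ?case
      using flow irr projective_imp_no_nontrivial_irreducible_extension [OF P]
      by (auto simp: maximal_irreducible_over_def)
  next
    case (2 L \<beta>)
    obtain p where "affine_flow_iso G P \<eta> L \<beta> p"
      using P_a 2 by (rule projective_iso_maximal)
    with flow projective_imp_no_nontrivial_irreducible_extension [OF P_b]
    have "no_nontrivial_irreducible_extension TYPE('b) G T L \<beta>"
      by (rule no_nontrivial_irreducible_extension_iso)
    with 2 show ?case
      by (simp add: maximal_irreducible_over_def)
  next
    case (3 L \<beta> L' \<beta>')
    obtain p where p: "affine_flow_iso G P \<eta> L \<beta> p"
      using P_a conjunct1 [OF 3] by (rule projective_iso_maximal)
    obtain p' where p': "affine_flow_iso G P \<eta> L' \<beta>' p'"
      using P_b conjunct2 [OF 3] by (rule projective_iso_maximal)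
    note inv = affine_flow_iso_inv_into [OF flow p]
    have "affine_G_map G L \<beta> L' \<beta>' (\<lambda>x. p' (inv_into P p x))"
      using affine_flow_isoD(1) [OF inv] affine_flow_isoD(1) [OF p'] by (rule affine_G_map_compose)
    moreover have "bij_betw (\<lambda>x. p' (inv_into P p x)) L L'"
      using inv p' bij_betw_trans [of "inv_into P p" L P p' L']
      by (simp add: affine_flow_iso_def o_def)
    ultimately show ?case
      by (auto simp: affine_flow_iso_def)
  qed
qed

end
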